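(* The $\pi^{MPM}$-calculus is weakly replacement free, i.e. it is replacement free but not strongly replacement free.
   Context: The $\pi^{MPM}$-calculus extends the $\pi$-calculus simultaneously with match, polyadic synchronization and pattern matching. Syntax: $P,Q ::= 0 \mid \mu.P \mid P+Q \mid P\mid Q \mid (\nu n)P \mid\, !P \mid [n=m]P$ and $\mu ::= \tau \mid \tilde a(\tilde x) \mid \overline{\tilde a}\langle \tilde n\rangle$. Here $[n=m]P$ behaves as $P$ if the names $n$ and $m$ coincide and is stuck otherwise; the subjects of input and output are tuples of names $\tilde a$, and an input and output can synchronize only if their subject tuples coincide; the object of an input is a pattern, a tuple of names some of which are marked $\lceil x\rceil$ (such names stand for themselves and are not affected by substitutions, $\lceil x\rceil\sigma=\lceil x\rceil$), while the others are placeholders; a pattern $\tilde x$ matches a tuple $\tilde b$ of the same length if there is a least substitution $\sigma$ with $\tilde x\sigma=\tilde b$ (after removing the marks), in which case $\tilde a(\tilde x).P \mid \overline{\tilde a}\langle\tilde b\rangle.Q \xrightarrow{\tau} P\sigma\mid Q$. The rest of the labelled transition semantics is as in the $\pi$-calculus; actions other than $\tau$ are visible. $\mathrm{fn}(P)$ is the set of free names; $P$ is closed if $\mathrm{fn}(P)=\emptyset$. A context is a term with one hole. $\Rightarrow$ is the reflexive-transitive closure of $\xrightarrow{\tau}$; $P\Downarrow$ iff $P\Rightarrow\xrightarrow{\alpha}\Rightarrow P'$ for some visible $\alpha$ and $P'$; $P$ is invisible iff not $P\Downarrow$. A calculus is strongly replacement free if for every context $C$, invisible process $I$ and process $P$,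 $C[I]\Downarrow$ implies $C[P]\Downarrow$; it is replacement free if this holds for every context $C$, closed invisible process $I$ and process $P$. *)

theory Defs
  imports Main
begin

type_synonym name = nat

text \<open>
  Patterns are lists of marked names and placeholders.  Only the placeholders of an input are
  binding; a placeholder may occur several times in a pattern.
\<close>

datatype pat_elem = Mark name | Place name

datatype "prefix" =
    Tau
  | Inp "name list" "pat_elem list"
  | Out "name list" "name list"

datatype proc =
    PNil
  | Pre "prefix" proc
  | Sum proc proc
  | Par proc proc
  | Res name proc
  | Bang proc
  | Match name name proc

definition marked :: "pat_elem list \<Rightarrow> name set" where
  "marked xs = {n. Mark n \<in> set xs}"

definition places :: "pat_elem list \<Rightarrow> name set" where
  "places xs = {x. Place x \<in> set xs}"

fun fn :: "proc \<Rightarrow> name set" where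
  "fn PNil = {}"
| "fn (Pre Tau P) = fn P"
| "fn (Pre (Inp as xs) P) = set as \<union> marked xs \<union> (fn P - places xs)"
| "fn (Pre (Out as bs) P) = set as \<union> set bs \<union> fn P"
| "fn (Sum P Q) = fn P \<union> fn Q"
| "fn (Par P Q) = fn P \<union> fn Q"
| "fn (Res n P) = fn P - {n}"
| "fn (Bang P) = fn P"
| "fn (Match n m P) = {n, m} \<union> fn P"

definition closed_proc :: "proc \<Rightarrow> bool" where
  "closed_proc P \<longleftrightarrow> fn P = {}"


subsection \<open>Substitution and alpha-conversion\<close>

text \<open>
  A substitution is a total function on names that is the identity outside its domain.
  Substitution on processes is simultaneous and capture-avoiding: a binder is replaced by names
  that lie above all names that are free in the scope of that binder after the substitution.
  The names chosen depend on the positions of the placeholders only, not on their identity.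

  A marked name of an input is a free name of that input, in the scope of the surrounding
  binders.  It is therefore instantiated together with these binders, both by alpha-conversion
  and by an enclosing input; it is the matching substitution of the input itself that leaves it
  alone (see \<open>pat_inst\<close> below).
\<close>

definition above :: "name set \<Rightarrow> name" where
  "above S = (LEAST k. \<forall>n \<in> S. n < k)"

definition first_pos :: "pat_elem list \<Rightarrow> name \<Rightarrow> nat" where
  "first_pos xs x = length (takeWhile (\<lambda>p. p \<noteq> Place x) xs)"

definition freshen :: "(name \<Rightarrow> name) \<Rightarrow> pat_elem list \<Rightarrow> name set \<Rightarrow> name \<Rightarrow> name" where
  "freshen \<sigma> xs F =
     override_on \<sigma> (\<lambda>x. above (\<sigma> ` (F - places xs)) + first_pos xs x) (places xs)"

text \<open>\<open>pat_map \<sigma> \<rho>\<close> applies \<open>\<sigma>\<close> to the free names of a pattern and \<open>\<rho>\<close> to its binding ones.\<close>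

definition pat_map :: "(name \<Rightarrow> name) \<Rightarrow> (name \<Rightarrow> name) \<Rightarrow> pat_elem list \<Rightarrow> pat_elem list" where
  "pat_map \<sigma> \<rho> xs = map (\<lambda>p. case p of Mark n \<Rightarrow> Mark (\<sigma> n) | Place x \<Rightarrow> Place (\<rho> x)) xs"

fun subst :: "(name \<Rightarrow> name) \<Rightarrow> proc \<Rightarrow> proc" where
  "subst \<sigma> PNil = PNil"
| "subst \<sigma> (Pre Tau P) = Pre Tau (subst \<sigma> P)"
| "subst \<sigma> (Pre (Inp as xs) P) =
     (let \<rho> = freshen \<sigma> xs (fn P)
      in Pre (Inp (map \<sigma> as) (pat_map \<sigma> \<rho> xs)) (subst \<rho> P))"
| "subst \<sigma> (Pre (Out as bs) P) = Pre (Out (map \<sigma> as) (map \<sigma> bs)) (subst \<sigma> P)"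
| "subst \<sigma> (Sum P Q) = Sum (subst \<sigma> P) (subst \<sigma> Q)"
| "subst \<sigma> (Par P Q) = Par (subst \<sigma> P) (subst \<sigma> Q)"
| "subst \<sigma> (Res n P) =
     (let m = above (\<sigma> ` (fn P - {n})) in Res m (subst (\<sigma>(n := m)) P))"
| "subst \<sigma> (Bang P) = Bang (subst \<sigma> P)"
| "subst \<sigma> (Match n m P) = Match (\<sigma> n) (\<sigma> m) (subst \<sigma> P)"

inductive alpha :: "proc \<Rightarrow> proc \<Rightarrow> bool" (infix "\<equiv>\<^sub>\<alpha>" 50) where
  alpha_refl: "P \<equiv>\<^sub>\<alpha> P"
| alpha_sym: "P \<equiv>\<^sub>\<alpha> Q \<Longrightarrow> Q \<equiv>\<^sub>\<alpha> P"
| alpha_trans: "P \<equiv>\<^sub>\<alpha> Q \<Longrightarrow> Q \<equiv>\<^sub>\<alpha> R \<Longrightarrow> P \<equiv>\<^sub>\<alpha> R"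
| alpha_Pre: "P \<equiv>\<^sub>\<alpha> P' \<Longrightarrow> Pre \<mu> P \<equiv>\<^sub>\<alpha> Pre \<mu> P'"
| alpha_Sum: "P \<equiv>\<^sub>\<alpha> P' \<Longrightarrow> Q \<equiv>\<^sub>\<alpha> Q' \<Longrightarrow> Sum P Q \<equiv>\<^sub>\<alpha> Sum P' Q'"
| alpha_Par: "P \<equiv>\<^sub>\<alpha> P' \<Longrightarrow> Q \<equiv>\<^sub>\<alpha> Q' \<Longrightarrow> Par P Q \<equiv>\<^sub>\<alpha> Par P' Q'"
| alpha_Res: "P \<equiv>\<^sub>\<alpha> P' \<Longrightarrow> Res n P \<equiv>\<^sub>\<alpha> Res n P'"
| alpha_Bang: "P \<equiv>\<^sub>\<alpha> P' \<Longrightarrow> Bang P \<equiv>\<^sub>\<alpha> Bang P'"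
| alpha_Match: "P \<equiv>\<^sub>\<alpha> P' \<Longrightarrow> Match n m P \<equiv>\<^sub>\<alpha> Match n m P'"
| alpha_conv_Res: "m \<notin> fn P - {n} \<Longrightarrow> Res n P \<equiv>\<^sub>\<alpha> Res m (subst (id(n := m)) P)"
| alpha_conv_Inp:
    "inj_on \<rho> (places xs) \<Longrightarrow> \<rho> ` places xs \<inter> (fn P - places xs) = {} \<Longrightarrow>
     Pre (Inp as xs) P \<equiv>\<^sub>\<alpha> Pre (Inp as (pat_map id \<rho> xs)) (subst (override_on id \<rho> (places xs)) P)"


subsection \<open>Pattern matching\<close>

text \<open>\<open>pat_inst \<sigma> xs\<close> is the pattern \<open>xs\<close> under \<open>\<sigma>\<close>, which does not affect the marked names,
  with the marks removed.\<close>

definition pat_inst :: "(name \<Rightarrow> name) \<Rightarrow> pat_elem list \<Rightarrow> name list" where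
  "pat_inst \<sigma> xs = map (\<lambda>p. case p of Mark n \<Rightarrow> n | Place x \<Rightarrow> \<sigma> x) xs"

text \<open>The inclusion order on substitutions, seen as sets of non-trivial bindings.\<close>

definition subst_le :: "(name \<Rightarrow> name) \<Rightarrow> (name \<Rightarrow> name) \<Rightarrow> bool" where
  "subst_le \<sigma> \<tau> \<longleftrightarrow> (\<forall>x. \<sigma> x \<noteq> x \<longrightarrow> \<tau> x = \<sigma> x)"

definition pat_match :: "pat_elem list \<Rightarrow> name list \<Rightarrow> (name \<Rightarrow> name) \<Rightarrow> bool" where
  "pat_match xs bs \<sigma> \<longleftrightarrow>
     pat_inst \<sigma> xs = bs \<and> (\<forall>\<tau>. pat_inst \<tau> xs = bs \<longrightarrow> subst_le \<sigma> \<tau>)"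


subsection \<open>Labelled transitions\<close>

text \<open>
  The semantics is early: \<open>AInp as bs\<close> is the reception of the tuple \<open>bs\<close>, and \<open>AOut as ns bs\<close> is
  the output of \<open>bs\<close> in which the private names \<open>ns\<close> are extruded.
\<close>

datatype action =
    ATau
  | AInp "name list" "name list"
  | AOut "name list" "name list" "name list"

fun bn :: "action \<Rightarrow> name set" where
  "bn (AOut as ns bs) = set ns"
| "bn _ = {}"

fun names :: "action \<Rightarrow> name set" where
  "names ATau = {}"
| "names (AInp as bs) = set as \<union> set bs"
| "names (AOut as ns bs) = set as \<union> set ns \<union> set bs"

definition visible :: "action \<Rightarrow> bool" where
  "visible \<alpha> \<longleftrightarrow> \<alpha> \<noteq> ATau"

text \<open>The rule \<open>Alpha\<close> makes this a transition relation on processes up to alpha-conversion.\<close>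

inductive step :: "proc \<Rightarrow> action \<Rightarrow> proc \<Rightarrow> bool" where
  Tau: "step (Pre Tau P) ATau P"
| Inp: "pat_match xs bs \<sigma> \<Longrightarrow> step (Pre (Inp as xs) P) (AInp as bs) (subst \<sigma> P)"
| Out: "step (Pre (Out as bs) P) (AOut as [] bs) P"
| SumL: "step P \<alpha> P' \<Longrightarrow> step (Sum P Q) \<alpha> P'"
| SumR: "step Q \<alpha> Q' \<Longrightarrow> step (Sum P Q) \<alpha> Q'"
| ParL: "step P \<alpha> P' \<Longrightarrow> bn \<alpha> \<inter> fn Q = {} \<Longrightarrow> step (Par P Q) \<alpha> (Par P' Q)"
| ParR: "step Q \<alpha> Q' \<Longrightarrow> bn \<alpha> \<inter> fn P = {} \<Longrightarrow> step (Par P Q) \<alpha> (Par P Q')"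
| ComL: "step P (AInp as bs) P' \<Longrightarrow> step Q (AOut as ns bs) Q' \<Longrightarrow> set ns \<inter> fn P = {} \<Longrightarrow>
    step (Par P Q) ATau (foldr Res ns (Par P' Q'))"
| ComR: "step P (AOut as ns bs) P' \<Longrightarrow> step Q (AInp as bs) Q' \<Longrightarrow> set ns \<inter> fn Q = {} \<Longrightarrow>
    step (Par P Q) ATau (foldr Res ns (Par P' Q'))"
| Res: "step P \<alpha> P' \<Longrightarrow> n \<notin> names \<alpha> \<Longrightarrow> step (Res n P) \<alpha> (Res n P')"
| Open: "step P (AOut as ns bs) P' \<Longrightarrow> n \<in> set bs \<Longrightarrow> n \<notin> set as \<union> set ns \<Longrightarrow>
    step (Res n P) (AOut as (n # ns) bs) P'"
| Bang: "step (Par P (Bang P)) \<alpha> P' \<Longrightarrow> step (Bang P) \<alpha> P'"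
| Match: "step P \<alpha> P' \<Longrightarrow> step (Match n n P) \<alpha> P'"
| Alpha: "P \<equiv>\<^sub>\<alpha> Q \<Longrightarrow> step Q \<alpha> Q' \<Longrightarrow> Q' \<equiv>\<^sub>\<alpha> P' \<Longrightarrow> step P \<alpha> P'"

definition weak :: "proc \<Rightarrow> proc \<Rightarrow> bool" where
  "weak = (\<lambda>P Q. step P ATau Q)\<^sup>*\<^sup>*"

definition may_act :: "proc \<Rightarrow> bool" ("_ \<Down>" [60] 60) where
  "P \<Down> \<longleftrightarrow> (\<exists>\<alpha> Q Q' P'. visible \<alpha> \<and> weak P Q \<and> step Q \<alpha> Q' \<and> weak Q' P')"

definition invisible :: "proc \<Rightarrow> bool" where
  "invisible P \<longleftrightarrow> \<not> P \<Down>"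


subsection \<open>Contexts and replacement freeness\<close>

datatype ctx =
    Hole
  | CPre "prefix" ctx
  | CSumL ctx proc
  | CSumR proc ctx
  | CParL ctx proc
  | CParR proc ctx
  | CRes name ctx
  | CBang ctx
  | CMatch name name ctx

text \<open>The binders of a context capture the free names of the process that fills the hole.\<close>

fun fill :: "ctx \<Rightarrow> proc \<Rightarrow> proc" where
  "fill Hole P = P"
| "fill (CPre \<mu> C) P = Pre \<mu> (fill C P)"
| "fill (CSumL C Q) P = Sum (fill C P) Q"
| "fill (CSumR Q C) P = Sum Q (fill C P)"
| "fill (CParL C Q) P = Par (fill C P) Q"
| "fill (CParR Q C) P = Par Q (fill C P)"
| "fill (CRes n C) P = Res n (fill C P)"
| "fill (CBang C) P = Bang (fill C P)"
| "fill (CMatch n m C) P = Match n m (fill C P)"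

definition strongly_replacement_free :: bool where
  "strongly_replacement_free \<longleftrightarrow>
     (\<forall>C I P. invisible I \<longrightarrow> fill C I \<Down> \<longrightarrow> fill C P \<Down>)"

definition replacement_free :: bool where
  "replacement_free \<longleftrightarrow>
     (\<forall>C I P. closed_proc I \<and> invisible I \<longrightarrow> fill C I \<Down> \<longrightarrow> fill C P \<Down>)"

definition weakly_replacement_free :: bool where
  "weakly_replacement_free \<longleftrightarrow> replacement_free \<and> \<not> strongly_replacement_free"

end

(*
  Processes are interpreted, relative to an environment for their free names, as trees in which
  binders are functions; alpha-equivalent processes get equal trees.  On trees, replacing closed
  invisible subterms by arbitrary ones is a plain structural relation, not affected by the names
  that the new subterms may capture.  This relation is a weak simulation: a hole on the left is
  closed and invisible, so it makes internal steps only, which the right-hand side answers by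
  staying put.  Bound and extruded names are handled by proving the simulation for all injective
  renamings of the left-hand side.  The relation without holes shows that visibility depends on
  the tree only, so that the holes are stable under alpha-conversion and substitution.

  Strong replacement freeness fails because [x = y]a is invisible, but a surrounding input can
  identify x and y.
*)
theory Submission
  imports Defs
begin

text \<open>No relation on the syntax survives the semantics. \<open>subst\<close> picks new binders
  from the free names of their scope, so putting \<open>P\<close> for \<open>I\<close> changes the
  names picked around the hole, and the rule \<open>Alpha\<close> may rename binders at any point of
  a derivation. Moreover, \<open>P\<close> may have free names that the closed \<open>I\<close>
  lacks: a name that the left-hand side extrudes may be free on the right, where the side conditions
  of \<open>ParL\<close> or \<open>ComL\<close> may then fail. Such a name is moved to a fresh one,
  and injectivity keeps the inequalities between names that \<open>Res\<close> and
  \<open>Open\<close> demand. For the negative result, the context around \<open>PNil\<close> has to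
  be invisible; this follows from an invariant saying that the subject of every prefix contains a
  restricted name.\<close>

section \<open>Patterns, matching and free names under substitution\<close>

lemma finite_marked [simp]: "finite (marked xs)"
proof -
  have "marked xs \<subseteq> (\<lambda>p. case p of Mark n \<Rightarrow> n | Place n \<Rightarrow> n) ` set xs"
    by (force simp: marked_def)
  then show ?thesis by (rule finite_subset) simp
qed

lemma finite_places [simp]: "finite (places xs)"
proof -
  have "places xs \<subseteq> (\<lambda>p. case p of Mark n \<Rightarrow> n | Place n \<Rightarrow> n) ` set xs"
    by (force simp: places_def)
  then show ?thesis by (rule finite_subset) simp
qed

lemma finite_fn [simp]: "finite (fn P)"
  by (induction P rule: fn.induct) auto

lemma above_less:
  assumes "finite S" "n \<in> S"
  shows "n < above S"
proof -
  have "\<forall>n \<in> S. n < Suc (Max S)" using assms(1) by (simp add: le_imp_less_Suc)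
  then have "\<forall>n \<in> S. n < above S" unfolding above_def by (rule LeastI)
  then show ?thesis using assms(2) by blast
qed

lemma first_pos_less: "x \<in> places xs \<Longrightarrow> first_pos xs x < length xs"
  unfolding first_pos_def places_def
  by (induction xs) (auto split: if_splits)

lemma nth_first_pos: "x \<in> places xs \<Longrightarrow> xs ! first_pos xs x = Place x"
  using first_pos_less[of x xs] nth_length_takeWhile[of "\<lambda>p. p \<noteq> Place x" xs]
  by (auto simp: first_pos_def)

lemma inj_on_first_pos: "inj_on (first_pos xs) (places xs)"
  by (metis inj_onI nth_first_pos pat_elem.inject(2))

lemma places_pat_map [simp]: "places (pat_map \<theta> \<rho> xs) = \<rho> ` places xs"
  by (force simp: places_def pat_map_def split: pat_elem.splits)

lemma marked_pat_map [simp]: "marked (pat_map \<theta> \<rho> xs) = \<theta> ` marked xs"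
  by (force simp: marked_def pat_map_def split: pat_elem.splits)

lemma length_pat_map [simp]: "length (pat_map \<theta> \<rho> xs) = length xs"
  by (simp add: pat_map_def)

lemma pat_map_pat_map: "pat_map \<theta> \<rho> (pat_map \<theta>' \<rho>' xs) = pat_map (\<theta> \<circ> \<theta>') (\<rho> \<circ> \<rho>') xs"
  by (auto simp: pat_map_def split: pat_elem.splits)

lemma pat_map_cong:
  "(\<And>x. x \<in> marked xs \<Longrightarrow> \<theta> x = \<theta>' x) \<Longrightarrow> (\<And>x. x \<in> places xs \<Longrightarrow> \<rho> x = \<rho>' x)
   \<Longrightarrow> pat_map \<theta> \<rho> xs = pat_map \<theta>' \<rho>' xs"
  by (auto simp: pat_map_def marked_def places_def split: pat_elem.splits)

lemma first_pos_pat_map: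
  assumes "inj_on \<rho> (places xs)" "x \<in> places xs"
  shows "first_pos (pat_map \<theta> \<rho> xs) (\<rho> x) = first_pos xs x"
proof -
  have "takeWhile (\<lambda>p. p \<noteq> Place (\<rho> x)) (pat_map \<theta> \<rho> xs)
     = map (\<lambda>p. case p of Mark n \<Rightarrow> Mark (\<theta> n) | Place x \<Rightarrow> Place (\<rho> x))
         (takeWhile (\<lambda>p. p \<noteq> Place x) xs)"
    unfolding pat_map_def takeWhile_map
    by (intro arg_cong[where f = "map _"] takeWhile_cong)
      (use assms in \<open>auto simp: places_def inj_on_def split: pat_elem.splits\<close>)
  then show ?thesis by (simp add: first_pos_def)
qed

text \<open>Replacing each placeholder by its first position makes alpha-equivalent patterns equal.\<close>

definition canon_pat :: "(name \<Rightarrow> name) \<Rightarrow> pat_elem list \<Rightarrow> pat_elem list" where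
  "canon_pat \<sigma> xs = pat_map \<sigma> (first_pos xs) xs"

text \<open>The environment under an input that has received \<open>bs\<close>: at \<open>id\<close>
  it is the candidate for the matching substitution, at any other \<sigma> it is how
  \<open>sem\<close> passes the binder. A repeated placeholder reads its first position only;
  consistency of its other positions is left to the matching equation.\<close>

definition bind_pat :: "(name \<Rightarrow> name) \<Rightarrow> pat_elem list \<Rightarrow> name list \<Rightarrow> name \<Rightarrow> name" where
  "bind_pat \<sigma> xs bs = override_on \<sigma> (\<lambda>x. bs ! first_pos xs x) (places xs)"

lemma length_canon_pat [simp]: "length (canon_pat \<sigma> xs) = length xs"
  by (simp add: canon_pat_def)

lemma canon_pat_pat_map:
  "inj_on \<rho> (places xs) \<Longrightarrow> canon_pat \<sigma> (pat_map \<theta> \<rho> xs) = canon_pat (\<sigma> \<circ> \<theta>) xs"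
  unfolding canon_pat_def pat_map_pat_map
  by (rule pat_map_cong) (auto simp: first_pos_pat_map)

lemma canon_pat_comp: "canon_pat (\<rho> \<circ> \<sigma>) xs = pat_map \<rho> id (canon_pat \<sigma> xs)"
  by (simp add: canon_pat_def pat_map_pat_map)

lemma pat_inst_bind:
  "pat_inst (bind_pat id xs bs) xs = pat_inst (nth bs) (canon_pat id xs)"
  by (auto simp: pat_inst_def canon_pat_def pat_map_def bind_pat_def places_def split: pat_elem.splits)

lemma pat_inst_cong_iff:
  "pat_inst \<sigma> xs = pat_inst \<tau> xs \<longleftrightarrow> (\<forall>x \<in> places xs. \<sigma> x = \<tau> x)"
  by (auto simp: pat_inst_def places_def split: pat_elem.splits)

lemma pat_inst_nth:
  "x \<in> places xs \<Longrightarrow> pat_inst \<sigma> xs ! first_pos xs x = \<sigma> x"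
  by (simp add: pat_inst_def first_pos_less nth_first_pos)

text \<open>On placeholders the equation forces the values of \<sigma>; elsewhere, resetting
  \<sigma> to the identity still solves it, so leastness forces the identity. The resulting test
  sees \<open>xs\<close> only through \<open>canon_pat\<close>, hence can be read off the tree of an
  input. It also entails that \<open>bs\<close> is as long as \<open>xs\<close>.\<close>

lemma pat_match_iff:
  "pat_match xs bs \<sigma> \<longleftrightarrow> \<sigma> = bind_pat id xs bs \<and> pat_inst (nth bs) (canon_pat id xs) = bs"
proof
  assume m: "pat_match xs bs \<sigma>"
  then have i: "pat_inst \<sigma> xs = bs" by (simp add: pat_match_def)
  have "\<sigma> x = bind_pat id xs bs x" for x
  proof (cases "x \<in> places xs")
    case True
    then show ?thesis using pat_inst_nth[OF True, of \<sigma>] i by (simp add: bind_pat_def)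
  next
    case False
    then have "pat_inst (\<sigma>(x := x)) xs = pat_inst \<sigma> xs"
      by (auto simp: pat_inst_cong_iff)
    with m i have "subst_le \<sigma> (\<sigma>(x := x))" unfolding pat_match_def by blast
    then have "\<sigma> x = x" unfolding subst_le_def by (metis fun_upd_same)
    then show ?thesis using False by (simp add: bind_pat_def)
  qed
  then have "\<sigma> = bind_pat id xs bs" by blast
  then show "\<sigma> = bind_pat id xs bs \<and> pat_inst (nth bs) (canon_pat id xs) = bs"
    using i pat_inst_bind by metis
next
  assume a: "\<sigma> = bind_pat id xs bs \<and> pat_inst (nth bs) (canon_pat id xs) = bs"
  then have i: "pat_inst \<sigma> xs = bs" by (simp add: pat_inst_bind)
  moreover have "subst_le \<sigma> \<tau>" if "pat_inst \<tau> xs = bs" for \<tau>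
  proof -
    have "\<forall>x \<in> places xs. \<tau> x = \<sigma> x" using that i by (metis pat_inst_cong_iff)
    moreover have "\<forall>x. x \<notin> places xs \<longrightarrow> \<sigma> x = x" using a by (simp add: bind_pat_def)
    ultimately show ?thesis unfolding subst_le_def by metis
  qed
  ultimately show "pat_match xs bs \<sigma>" unfolding pat_match_def by blast
qed

lemma length_pat_inst [simp]: "length (pat_inst \<sigma> xs) = length xs"
  by (simp add: pat_inst_def)

text \<open>Lets the simulating input receive the renamed tuple: marks are renamed in the pattern,
  and placeholders, being positions, look up the renamed entries.\<close>

lemma pat_inst_canon_map:
  assumes "pat_inst (nth bs) (canon_pat id xs) = bs"
  shows "pat_inst (nth (map \<pi> bs)) (canon_pat \<pi> xs) = map \<pi> bs"
proof -
  have len: "length bs = length xs" using assms by (metis length_canon_pat length_pat_inst)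
  have "pat_inst (nth (map \<pi> bs)) (canon_pat \<pi> xs) = map \<pi> (pat_inst (nth bs) (canon_pat id xs))"
    using len first_pos_less[of _ xs]
    by (auto simp: pat_inst_def canon_pat_def pat_map_def places_def split: pat_elem.splits)
  then show ?thesis using assms by simp
qed

lemma inj_on_freshen: "inj_on (freshen \<sigma> xs F) (places xs)"
  using inj_on_first_pos[of xs] by (auto simp: freshen_def inj_on_def)

lemma freshen_outside:
  assumes "finite F" "x \<in> F - places xs"
  shows "freshen \<sigma> xs F x = \<sigma> x" "\<sigma> x \<notin> freshen \<sigma> xs F ` places xs"
proof -
  show "freshen \<sigma> xs F x = \<sigma> x" using assms by (simp add: freshen_def)
  have "\<sigma> x < above (\<sigma> ` (F - places xs))" using assms by (intro above_less) auto
  then show "\<sigma> x \<notin> freshen \<sigma> xs F ` places xs" by (auto simp: freshen_def)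
qed

lemma fn_subst: "fn (subst \<sigma> P) = \<sigma> ` fn P"
proof (induction \<sigma> P rule: subst.induct)
  case (3 \<sigma> as xs P)
  define \<rho> where "\<rho> = freshen \<sigma> xs (fn P)"
  have "\<rho> ` fn P - \<rho> ` places xs = \<sigma> ` (fn P - places xs)"
    using freshen_outside[of "fn P" _ xs \<sigma>] unfolding \<rho>_def by (auto simp: image_iff) (metis DiffI)+
  then show ?case using 3[OF refl] by (auto simp: Let_def \<rho>_def)
next
  case (7 \<sigma> n P)
  define m where "m = above (\<sigma> ` (fn P - {n}))"
  have "\<forall>x \<in> fn P - {n}. \<sigma> x \<noteq> m"
    using above_less[of "\<sigma> ` (fn P - {n})"] unfolding m_def by fastforce
  then have "\<sigma>(n := m) ` fn P - {m} = \<sigma> ` (fn P - {n})" by auto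
  then show ?case by (simp only: subst.simps fn.simps Let_def m_def 7[OF refl])
qed auto

lemma fn_alpha: "P \<equiv>\<^sub>\<alpha> Q \<Longrightarrow> fn P = fn Q"
proof (induction rule: alpha.induct)
  case (alpha_Pre P P' \<mu>)
  then show ?case by (cases \<mu>) auto
next
  case (alpha_conv_Res m P n)
  then show ?case by (auto simp: fn_subst)
next
  case (alpha_conv_Inp \<rho> xs P as)
  have "override_on id \<rho> (places xs) ` fn P - \<rho> ` places xs = fn P - places xs"
    using alpha_conv_Inp(2) by (auto simp: override_on_def image_iff split: if_splits)
  then show ?case by (auto simp: fn_subst)
qed auto

section \<open>A denotation that identifies alpha-equivalent processes\<close>

text \<open>
  Binders become functions, so that substitution turns into composition of environments.
  Binder nodes carry their free names; these are what makes closedness readable off the tree.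
\<close>

datatype tree =
    TNil
  | TTau tree
  | TInp "name set" "name list" "pat_elem list" "name list \<Rightarrow> tree"
  | TOut "name list" "name list" tree
  | TSum tree tree
  | TPar tree tree
  | TRes "name set" "name \<Rightarrow> tree"
  | TBang tree
  | TMatch name name tree

fun sem :: "(name \<Rightarrow> name) \<Rightarrow> proc \<Rightarrow> tree" where
  "sem \<sigma> PNil = TNil"
| "sem \<sigma> (Pre Tau P) = TTau (sem \<sigma> P)"
| "sem \<sigma> (Pre (Inp as xs) P) =
     TInp (\<sigma> ` fn (Pre (Inp as xs) P)) (map \<sigma> as) (canon_pat \<sigma> xs) (\<lambda>bs. sem (bind_pat \<sigma> xs bs) P)"
| "sem \<sigma> (Pre (Out as bs) P) = TOut (map \<sigma> as) (map \<sigma> bs) (sem \<sigma> P)"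
| "sem \<sigma> (Sum P Q) = TSum (sem \<sigma> P) (sem \<sigma> Q)"
| "sem \<sigma> (Par P Q) = TPar (sem \<sigma> P) (sem \<sigma> Q)"
| "sem \<sigma> (Res n P) = TRes (\<sigma> ` fn (Res n P)) (\<lambda>m. sem (\<sigma>(n := m)) P)"
| "sem \<sigma> (Bang P) = TBang (sem \<sigma> P)"
| "sem \<sigma> (Match n m P) = TMatch (\<sigma> n) (\<sigma> m) (sem \<sigma> P)"

primrec tfn :: "tree \<Rightarrow> name set" where
  "tfn TNil = {}"
| "tfn (TTau t) = tfn t"
| "tfn (TInp S as xs f) = S"
| "tfn (TOut as bs t) = set as \<union> set bs \<union> tfn t"
| "tfn (TSum t u) = tfn t \<union> tfn u"
| "tfn (TPar t u) = tfn t \<union> tfn u"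
| "tfn (TRes S f) = S"
| "tfn (TBang t) = tfn t"
| "tfn (TMatch n m t) = {n, m} \<union> tfn t"

lemma tfn_sem: "tfn (sem \<sigma> P) = \<sigma> ` fn P"
  by (induction \<sigma> P rule: sem.induct) (auto simp del: image_Un simp: image_Un)

lemma sem_cong: "(\<And>x. x \<in> fn P \<Longrightarrow> \<sigma> x = \<tau> x) \<Longrightarrow> sem \<sigma> P = sem \<tau> P"
proof (induction \<sigma> P arbitrary: \<tau> rule: sem.induct)
  case (3 \<sigma> as xs P)
  have "sem (bind_pat \<sigma> xs bs) P = sem (bind_pat \<tau> xs bs) P" for bs
    by (rule 3(1)) (use 3(2) in \<open>auto simp: bind_pat_def override_on_def\<close>)
  moreover have "canon_pat \<sigma> xs = canon_pat \<tau> xs"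
    unfolding canon_pat_def using 3(2) by (intro pat_map_cong) auto
  moreover have "\<sigma> ` fn (Pre (Inp as xs) P) = \<tau> ` fn (Pre (Inp as xs) P)"
    using 3(2) by (rule image_cong[OF refl])
  ultimately show ?case using 3(2) by (simp del: fn.simps) (simp)
next
  case (7 \<sigma> n P)
  have "sem (\<sigma>(n := m)) P = sem (\<tau>(n := m)) P" for m
    by (rule 7(1)) (use 7(2) in auto)
  moreover have "\<sigma> ` fn (Res n P) = \<tau> ` fn (Res n P)"
    using 7(2) by (rule image_cong[OF refl])
  ultimately show ?case by (simp del: fn.simps)
qed auto

text \<open>The second assumption is freedom from capture at \<open>x\<close>. It covers both
  renamings of placeholders: the one chosen by \<open>freshen\<close> in a substitution \<theta>,
  and alpha-conversion, where \<theta> is \<open>id\<close>.\<close>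

lemma bind_pat_pat_map:
  assumes "inj_on \<rho> (places xs)"
    and "x \<in> places xs \<or> \<rho> x = \<theta> x \<and> \<theta> x \<notin> \<rho> ` places xs"
  shows "bind_pat \<sigma> (pat_map \<theta> \<rho> xs) bs (\<rho> x) = bind_pat (\<sigma> \<circ> \<theta>) xs bs x"
proof (cases "x \<in> places xs")
  case True
  then show ?thesis using assms(1) by (simp add: bind_pat_def first_pos_pat_map)
next
  case False
  then show ?thesis using assms(2) by (simp add: bind_pat_def)
qed

text \<open>The names that \<open>subst\<close> chooses for binders vanish, since the environment
  overwrites them at once; being fresh, they overwrite nothing else.\<close>

lemma sem_subst: "sem \<sigma> (subst \<theta> P) = sem (\<sigma> \<circ> \<theta>) P"
proof (induction \<theta> P arbitrary: \<sigma> rule: subst.induct)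
  case (3 \<theta> as xs P)
  define \<rho> where "\<rho> = freshen \<theta> xs (fn P)"
  have inj: "inj_on \<rho> (places xs)" unfolding \<rho>_def by (rule inj_on_freshen)
  have "sem (bind_pat \<sigma> (pat_map \<theta> \<rho> xs) bs) (subst \<rho> P) = sem (bind_pat (\<sigma> \<circ> \<theta>) xs bs) P" for bs
  proof -
    have "sem (bind_pat \<sigma> (pat_map \<theta> \<rho> xs) bs \<circ> \<rho>) P = sem (bind_pat (\<sigma> \<circ> \<theta>) xs bs) P"
      using freshen_outside[of "fn P" _ xs \<theta>] unfolding \<rho>_def
      by (intro sem_cong) (auto intro!: bind_pat_pat_map inj_on_freshen)
    then show ?thesis by (simp only: 3[OF refl] \<rho>_def)
  qed
  moreover have "fn (subst \<theta> (Pre (Inp as xs) P)) = \<theta> ` fn (Pre (Inp as xs) P)"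
    by (rule fn_subst)
  ultimately show ?case using canon_pat_pat_map[OF inj, of \<sigma> \<theta>]
    by (simp add: Let_def \<rho>_def[symmetric] image_comp comp_def del: fn.simps)
next
  case (7 \<theta> n P)
  define m where "m = above (\<theta> ` (fn P - {n}))"
  have m: "\<forall>x \<in> fn P - {n}. \<theta> x \<noteq> m"
    using above_less[of "\<theta> ` (fn P - {n})"] unfolding m_def by fastforce
  have "sem (\<sigma>(m := k)) (subst (\<theta>(n := m)) P) = sem ((\<sigma> \<circ> \<theta>)(n := k)) P" for k
  proof -
    have "sem (\<sigma>(m := k) \<circ> \<theta>(n := m)) P = sem ((\<sigma> \<circ> \<theta>)(n := k)) P"
      by (rule sem_cong) (use m in auto)
    then show ?thesis by (simp only: 7[OF refl] m_def)
  qed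
  moreover have "fn (subst \<theta> (Res n P)) = \<theta> ` fn (Res n P)" by (rule fn_subst)
  ultimately show ?case by (simp add: Let_def m_def[symmetric] image_comp comp_def del: fn.simps)
qed (auto simp: comp_def)

lemma sem_alpha: "P \<equiv>\<^sub>\<alpha> Q \<Longrightarrow> sem \<sigma> P = sem \<sigma> Q"
proof (induction arbitrary: \<sigma> rule: alpha.induct)
  case (alpha_Pre P P' \<mu>)
  then show ?case using fn_alpha[OF alpha_Pre(1)] by (cases \<mu>) auto
next
  case (alpha_Res P P' n)
  then show ?case using fn_alpha[OF alpha_Res(1)] by (simp only: sem.simps fn.simps)
next
  case (alpha_conv_Res m P n)
  have "sem (\<sigma>(n := k)) P = sem (\<sigma>(m := k) \<circ> id(n := m)) P" for k
    by (rule sem_cong) (use alpha_conv_Res in auto)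
  moreover have "fn (Res n P) = fn (Res m (subst (id(n := m)) P))"
    by (rule fn_alpha) (rule alpha.alpha_conv_Res[OF alpha_conv_Res])
  ultimately show ?case by (simp add: sem_subst del: fn.simps)
next
  case (alpha_conv_Inp \<rho> xs P as)
  \<comment> \<open>The rule leaves \<rho> arbitrary outside the placeholders;
    \<open>\<rho>'\<close> is the identity there, as \<open>bind_pat_pat_map\<close> demands of
    names that are free under the input.\<close>
  define \<rho>' where "\<rho>' = override_on id \<rho> (places xs)"
  have img: "\<rho>' ` places xs = \<rho> ` places xs" by (simp add: \<rho>'_def)
  have inj: "inj_on \<rho>' (places xs)"
    using alpha_conv_Inp(1) by (simp add: \<rho>'_def inj_on_def)
  have pm: "pat_map id \<rho> xs = pat_map id \<rho>' xs"
    by (rule pat_map_cong) (auto simp: \<rho>'_def)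
  have "sem (bind_pat \<sigma> xs bs) P = sem (bind_pat \<sigma> (pat_map id \<rho>' xs) bs \<circ> \<rho>') P" for bs
  proof (rule sem_cong)
    fix x assume "x \<in> fn P"
    then have "x \<in> places xs \<or> \<rho>' x = id x \<and> id x \<notin> \<rho>' ` places xs"
      using alpha_conv_Inp(2) unfolding img by (auto simp: \<rho>'_def)
    from bind_pat_pat_map[where \<theta> = id, OF inj this, of \<sigma> bs]
    show "bind_pat \<sigma> xs bs x = (bind_pat \<sigma> (pat_map id \<rho>' xs) bs \<circ> \<rho>') x" by simp
  qed
  moreover have "fn (Pre (Inp as xs) P) = fn (Pre (Inp as (pat_map id \<rho> xs)) (subst \<rho>' P))"
    unfolding \<rho>'_def by (rule fn_alpha) (rule alpha.alpha_conv_Inp[OF alpha_conv_Inp])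
  ultimately show ?case
    using canon_pat_pat_map[OF inj, of \<sigma> id]
    by (simp add: sem_subst pm \<rho>'_def[symmetric] del: fn.simps)
qed auto

section \<open>A simulation up to holes\<close>

text \<open>Parametric in the relation on subtrees, so that \<open>tle\<close> can be defined and
  inverted through it. The stored name sets may differ, because a replacement may change free names,
  and only tuples as long as the pattern are compared, as no others can be received.\<close>

inductive cong :: "(tree \<Rightarrow> tree \<Rightarrow> bool) \<Rightarrow> tree \<Rightarrow> tree \<Rightarrow> bool" for R where
  "cong R TNil TNil"
| "R t u \<Longrightarrow> cong R (TTau t) (TTau u)"
| "(\<And>bs. length bs = length xs \<Longrightarrow> R (f bs) (g bs)) \<Longrightarrow> cong R (TInp S as xs f) (TInp S' as xs g)"
| "R t u \<Longrightarrow> cong R (TOut as bs t) (TOut as bs u)"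
| "R t u \<Longrightarrow> R t' u' \<Longrightarrow> cong R (TSum t t') (TSum u u')"
| "R t u \<Longrightarrow> R t' u' \<Longrightarrow> cong R (TPar t t') (TPar u u')"
| "(\<And>m. R (f m) (g m)) \<Longrightarrow> cong R (TRes S f) (TRes S' g)"
| "R t u \<Longrightarrow> cong R (TBang t) (TBang u)"
| "R t u \<Longrightarrow> cong R (TMatch n m t) (TMatch n m u)"

lemma cong_mono [mono]:
  "(\<And>t u. R t u \<longrightarrow> R' t u) \<Longrightarrow> cong R t u \<longrightarrow> cong R' t u"
  by (intro impI, erule cong.cases) (auto intro!: cong.intros)

inductive_cases cong_TTauE: "cong R (TTau t) u"
inductive_cases cong_TInpE: "cong R (TInp S as xs f) u"
inductive_cases cong_TOutE: "cong R (TOut as bs t) u"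
inductive_cases cong_TSumE: "cong R (TSum t t') u"
inductive_cases cong_TParE: "cong R (TPar t t') u"
inductive_cases cong_TResE: "cong R (TRes S f) u"
inductive_cases cong_TBangE: "cong R (TBang t) u"
inductive_cases cong_TMatchE: "cong R (TMatch n m t) u"

text \<open>
  \<open>B\<close> is the set of trees that may be replaced by anything.  A hole can make internal steps that
  resolve a choice, unfold a replication or pass a match; the right-hand side then stays put,
  and the last four rules keep the two sides related.
\<close>

inductive tle :: "tree set \<Rightarrow> tree \<Rightarrow> tree \<Rightarrow> bool" for B where
  hole: "t \<in> B \<Longrightarrow> tle B t u"
| cong: "cong (tle B) t u \<Longrightarrow> tle B t u"
| SumL: "tle B t u \<Longrightarrow> tle B t (TSum u u')"
| SumR: "tle B t u' \<Longrightarrow> tle B t (TSum u u')"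
| Bang: "tle B t (TPar u (TBang u)) \<Longrightarrow> tle B t (TBang u)"
| Match: "tle B t u \<Longrightarrow> tle B t (TMatch n n u)"

lemma tle_refl: "tle B t t"
proof (induction t)
  case (TInp S as xs f)
  then show ?case by (simp add: tle.cong cong.intros(3))
next
  case (TRes S f)
  then show ?case by (simp add: tle.cong cong.intros(7))
qed (simp_all add: tle.cong cong.intros)

text \<open>Transitions live on processes and \<open>tle\<close> on trees; this inversion and its
  companions recover the head of a process from the top node of its tree.\<close>

lemma sem_eq_TTau: "TTau t = sem \<sigma> P \<Longrightarrow> \<exists>P'. P = Pre Tau P' \<and> t = sem \<sigma> P'"
  by (cases "(\<sigma>, P)" rule: sem.cases) auto

lemma sem_eq_TInp:
  "TInp S as cs f = sem \<sigma> P \<Longrightarrow> \<exists>as' xs P'. P = Pre (Inp as' xs) P' \<and> as = map \<sigma> as' \<and>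
     cs = canon_pat \<sigma> xs \<and> f = (\<lambda>bs. sem (bind_pat \<sigma> xs bs) P')"
  by (cases "(\<sigma>, P)" rule: sem.cases) auto

lemma sem_eq_TOut:
  "TOut as bs t = sem \<sigma> P \<Longrightarrow>
   \<exists>as' bs' P'. P = Pre (Out as' bs') P' \<and> as = map \<sigma> as' \<and> bs = map \<sigma> bs' \<and> t = sem \<sigma> P'"
  by (cases "(\<sigma>, P)" rule: sem.cases) auto

lemma sem_eq_TSum: "TSum t u = sem \<sigma> P \<Longrightarrow> \<exists>P1 P2. P = Sum P1 P2 \<and> t = sem \<sigma> P1 \<and> u = sem \<sigma> P2"
  by (cases "(\<sigma>, P)" rule: sem.cases) auto

lemma sem_eq_TPar: "TPar t u = sem \<sigma> P \<Longrightarrow> \<exists>P1 P2. P = Par P1 P2 \<and> t = sem \<sigma> P1 \<and> u = sem \<sigma> P2"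
  by (cases "(\<sigma>, P)" rule: sem.cases) auto

lemma sem_eq_TRes: "TRes S f = sem \<sigma> P \<Longrightarrow> \<exists>n P'. P = Res n P' \<and> f = (\<lambda>m. sem (\<sigma>(n := m)) P')"
  by (cases "(\<sigma>, P)" rule: sem.cases) auto

lemma sem_eq_TBang: "TBang t = sem \<sigma> P \<Longrightarrow> \<exists>P'. P = Bang P' \<and> t = sem \<sigma> P'"
  by (cases "(\<sigma>, P)" rule: sem.cases) auto

lemma sem_eq_TMatch:
  "TMatch n m t = sem \<sigma> P \<Longrightarrow> \<exists>n' m' P'. P = Match n' m' P' \<and> n = \<sigma> n' \<and> m = \<sigma> m' \<and> t = sem \<sigma> P'"
  by (cases "(\<sigma>, P)" rule: sem.cases) auto

lemma sem_eq_TNil: "TNil = sem \<sigma> P \<Longrightarrow> P = PNil"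
  by (cases "(\<sigma>, P)" rule: sem.cases) auto

lemmas sem_eq = sem_eq_TNil sem_eq_TTau sem_eq_TInp sem_eq_TOut sem_eq_TSum sem_eq_TPar
  sem_eq_TRes sem_eq_TBang sem_eq_TMatch

text \<open>
  A family of trees indexed by received or restricted names is determined by its instance at
  fresh names, so only that instance of the induction hypothesis is used below.
\<close>

lemma tle_comp:
  assumes "tle B t u" and hole: "\<And>\<sigma> P. sem \<sigma> P \<in> B \<Longrightarrow> fn P = {}"
  shows "t = sem \<sigma> P \<Longrightarrow> u = sem \<tau> Q \<Longrightarrow> tle B (sem (\<rho> \<circ> \<sigma>) P) (sem (\<rho> \<circ> \<tau>) Q)"
  using assms(1)
proof (induction arbitrary: \<sigma> P \<tau> Q \<rho>)
  case (hole t u)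
  then have "sem (\<rho> \<circ> \<sigma>) P = sem \<sigma> P" using assms(2) by (intro sem_cong) blast
  then show ?case using hole(1,2) by (metis tle.hole)
next
  case (cong t u)
  define R where "R t u \<longleftrightarrow> tle B t u \<and> (\<forall>\<sigma> P. t = sem \<sigma> P \<longrightarrow>
    (\<forall>\<tau> Q. u = sem \<tau> Q \<longrightarrow> (\<forall>\<rho>. tle B (sem (\<rho> \<circ> \<sigma>) P) (sem (\<rho> \<circ> \<tau>) Q))))" for t u
  have R: "tle B (sem (\<rho> \<circ> \<sigma>) P) (sem (\<rho> \<circ> \<tau>) Q)" if "R (sem \<sigma> P) (sem \<tau> Q)" for \<sigma> P \<tau> Q \<rho>
    using that unfolding R_def by blast
  have "cong R t u"
    by (rule mp[OF cong_mono cong(1)]) (unfold R_def, blast)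
  then have "cong R (sem \<sigma> P) (sem \<tau> Q)" using cong by simp
  then have "cong (tle B) (sem (\<rho> \<circ> \<sigma>) P) (sem (\<rho> \<circ> \<tau>) Q)"
  proof (cases rule: cong.cases)
    case (3 cs f g S as S')
    obtain as1 xs P' where P: "P = Pre (Inp as1 xs) P'" "as = map \<sigma> as1" "cs = canon_pat \<sigma> xs"
      "f = (\<lambda>bs. sem (bind_pat \<sigma> xs bs) P')" using sem_eq_TInp[OF 3(1)[symmetric]] by blast
    obtain as2 ys Q' where Q: "Q = Pre (Inp as2 ys) Q'" "as = map \<tau> as2" "cs = canon_pat \<tau> ys"
      "g = (\<lambda>bs. sem (bind_pat \<tau> ys bs) Q')" using sem_eq_TInp[OF 3(2)[symmetric]] by blast
    have len: "length xs = length ys" using P(3) Q(3) by (metis length_canon_pat)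
    have "tle B (sem (bind_pat (\<rho> \<circ> \<sigma>) xs bs) P') (sem (bind_pat (\<rho> \<circ> \<tau>) ys bs) Q')"
      if bs: "length bs = length xs" for bs
    proof -
      define k where "k = above (\<sigma> ` fn P' \<union> \<tau> ` fn Q')"
      define ks where "ks = [k..<k + length xs]"
      \<comment> \<open>The entries of \<open>bs\<close> need not lie in the range of \<rho>. Hence
        the names \<open>ks\<close>, above all values of free names on both sides, are received
        first, and \<open>\<rho>'\<close> sends the i-th of them to the i-th entry of
        \<open>bs\<close>.\<close>
      define \<rho>' where "\<rho>' y = (if k \<le> y \<and> y < k + length xs then bs ! (y - k) else \<rho> y)" for y
      have k: "\<sigma> x < k" if "x \<in> fn P'" for x
        using that unfolding k_def by (intro above_less) auto
      have k': "\<tau> x < k" if "x \<in> fn Q'" for x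
        using that unfolding k_def by (intro above_less) auto
      have "R (sem (bind_pat \<sigma> xs ks) P') (sem (bind_pat \<tau> ys ks) Q')"
        using 3(3)[of ks] P Q by (simp add: ks_def)
      then have "tle B (sem (\<rho>' \<circ> bind_pat \<sigma> xs ks) P') (sem (\<rho>' \<circ> bind_pat \<tau> ys ks) Q')"
        by (rule R)
      moreover have "sem (\<rho>' \<circ> bind_pat \<sigma> xs ks) P' = sem (bind_pat (\<rho> \<circ> \<sigma>) xs bs) P'"
        using k first_pos_less[of _ xs]
        by (intro sem_cong) (fastforce simp: bind_pat_def override_on_def \<rho>'_def ks_def)
      moreover have "sem (\<rho>' \<circ> bind_pat \<tau> ys ks) Q' = sem (bind_pat (\<rho> \<circ> \<tau>) ys bs) Q'"
        using k' first_pos_less[of _ ys]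
        by (intro sem_cong) (fastforce simp: bind_pat_def override_on_def \<rho>'_def ks_def len)
      ultimately show ?thesis by simp
    qed
    moreover have "map (\<rho> \<circ> \<sigma>) as1 = map (\<rho> \<circ> \<tau>) as2"
      using P(2) Q(2) by (metis map_map)
    moreover have "canon_pat (\<rho> \<circ> \<sigma>) xs = canon_pat (\<rho> \<circ> \<tau>) ys"
      using P(3) Q(3) by (simp add: canon_pat_comp)
    ultimately show ?thesis
      unfolding P(1) Q(1) sem.simps by (metis (mono_tags, lifting) cong.intros(3) len length_canon_pat)
  next
    case (7 f g S S')
    obtain n P' where P: "P = Res n P'" "f = (\<lambda>m. sem (\<sigma>(n := m)) P')"
      using sem_eq_TRes[OF 7(1)[symmetric]] by blast
    obtain k Q' where Q: "Q = Res k Q'" "g = (\<lambda>m. sem (\<tau>(k := m)) Q')"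
      using sem_eq_TRes[OF 7(2)[symmetric]] by blast
    have "tle B (sem ((\<rho> \<circ> \<sigma>)(n := m)) P') (sem ((\<rho> \<circ> \<tau>)(k := m)) Q')" for m
    proof -
      define z where "z = above (\<sigma> ` fn P' \<union> \<tau> ` fn Q')"
      have z: "\<sigma> x < z" if "x \<in> fn P'" for x
        using that unfolding z_def by (intro above_less) auto
      have z': "\<tau> x < z" if "x \<in> fn Q'" for x
        using that unfolding z_def by (intro above_less) auto
      have "R (sem (\<sigma>(n := z)) P') (sem (\<tau>(k := z)) Q')" using 7(3)[of z] P Q by simp
      then have "tle B (sem (\<rho>(z := m) \<circ> \<sigma>(n := z)) P') (sem (\<rho>(z := m) \<circ> \<tau>(k := z)) Q')"
        by (rule R)
      moreover have "sem (\<rho>(z := m) \<circ> \<sigma>(n := z)) P' = sem ((\<rho> \<circ> \<sigma>)(n := m)) P'"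
        using z by (intro sem_cong) fastforce
      moreover have "sem (\<rho>(z := m) \<circ> \<tau>(k := z)) Q' = sem ((\<rho> \<circ> \<tau>)(k := m)) Q'"
        using z' by (intro sem_cong) fastforce
      ultimately show ?thesis by simp
    qed
    then show ?thesis unfolding P(1) Q(1) sem.simps by (rule cong.intros(7))
  next
    case 1
    then have "P = PNil" "Q = PNil" by (metis sem_eq_TNil)+
    then show ?thesis by (simp add: cong.intros)
  next
    case (2 t' u')
    obtain P' where P: "P = Pre Tau P'" "t' = sem \<sigma> P'" using sem_eq_TTau[OF 2(1)[symmetric]] by blast
    obtain Q' where Q: "Q = Pre Tau Q'" "u' = sem \<tau> Q'" using sem_eq_TTau[OF 2(2)[symmetric]] by blast
    show ?thesis unfolding P Q sem.simps by (intro cong.intros R 2(3)[unfolded P Q])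
  next
    case (4 t' u' as bs)
    obtain as1 bs1 P' where P: "P = Pre (Out as1 bs1) P'" "as = map \<sigma> as1" "bs = map \<sigma> bs1" "t' = sem \<sigma> P'"
      using sem_eq_TOut[OF 4(1)[symmetric]] by blast
    obtain as2 bs2 Q' where Q: "Q = Pre (Out as2 bs2) Q'" "as = map \<tau> as2" "bs = map \<tau> bs2" "u' = sem \<tau> Q'"
      using sem_eq_TOut[OF 4(2)[symmetric]] by blast
    have "map (\<rho> \<circ> \<sigma>) as1 = map (\<rho> \<circ> \<tau>) as2" "map (\<rho> \<circ> \<sigma>) bs1 = map (\<rho> \<circ> \<tau>) bs2"
      using P Q by (metis map_map)+
    moreover have "tle B (sem (\<rho> \<circ> \<sigma>) P') (sem (\<rho> \<circ> \<tau>) Q')" using 4(3) P(4) Q(4) R by blast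
    ultimately show ?thesis unfolding P(1) Q(1) sem.simps by (metis cong.intros(4))
  next
    case (5 t1 u1 t2 u2)
    obtain P1 P2 where P: "P = Sum P1 P2" "t1 = sem \<sigma> P1" "t2 = sem \<sigma> P2"
      using sem_eq_TSum[OF 5(1)[symmetric]] by blast
    obtain Q1 Q2 where Q: "Q = Sum Q1 Q2" "u1 = sem \<tau> Q1" "u2 = sem \<tau> Q2"
      using sem_eq_TSum[OF 5(2)[symmetric]] by blast
    show ?thesis unfolding P Q sem.simps by (intro cong.intros R 5(3,4)[unfolded P Q])
  next
    case (6 t1 u1 t2 u2)
    obtain P1 P2 where P: "P = Par P1 P2" "t1 = sem \<sigma> P1" "t2 = sem \<sigma> P2"
      using sem_eq_TPar[OF 6(1)[symmetric]] by blast
    obtain Q1 Q2 where Q: "Q = Par Q1 Q2" "u1 = sem \<tau> Q1" "u2 = sem \<tau> Q2"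
      using sem_eq_TPar[OF 6(2)[symmetric]] by blast
    show ?thesis unfolding P Q sem.simps by (intro cong.intros R 6(3,4)[unfolded P Q])
  next
    case (8 t' u')
    obtain P' where P: "P = Bang P'" "t' = sem \<sigma> P'" using sem_eq_TBang[OF 8(1)[symmetric]] by blast
    obtain Q' where Q: "Q = Bang Q'" "u' = sem \<tau> Q'" using sem_eq_TBang[OF 8(2)[symmetric]] by blast
    show ?thesis unfolding P Q sem.simps by (intro cong.intros R 8(3)[unfolded P Q])
  next
    case (9 t' u' n m)
    obtain n1 m1 P' where P: "P = Match n1 m1 P'" "n = \<sigma> n1" "m = \<sigma> m1" "t' = sem \<sigma> P'"
      using sem_eq_TMatch[OF 9(1)[symmetric]] by blast
    obtain n2 m2 Q' where Q: "Q = Match n2 m2 Q'" "n = \<tau> n2" "m = \<tau> m2" "u' = sem \<tau> Q'"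
      using sem_eq_TMatch[OF 9(2)[symmetric]] by blast
    have "tle B (sem (\<rho> \<circ> \<sigma>) P') (sem (\<rho> \<circ> \<tau>) Q')" using 9(3) P(4) Q(4) R by blast
    then show ?thesis
      unfolding P(1) Q(1) sem.simps comp_apply P(2,3)[symmetric] Q(2,3)[symmetric]
      by (rule cong.intros(9))
  qed
  then show ?case by (rule tle.cong)
next
  case (SumL t u u')
  obtain Q1 Q2 where Q: "Q = Sum Q1 Q2" "u = sem \<tau> Q1" using sem_eq_TSum[OF SumL.prems(2)] by blast
  show ?case unfolding Q(1) sem.simps by (rule tle.SumL) (rule SumL.IH[OF SumL.prems(1) Q(2)])
next
  case (SumR t u' u)
  obtain Q1 Q2 where Q: "Q = Sum Q1 Q2" "u' = sem \<tau> Q2" using sem_eq_TSum[OF SumR.prems(2)] by blast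
  show ?case unfolding Q(1) sem.simps by (rule tle.SumR) (rule SumR.IH[OF SumR.prems(1) Q(2)])
next
  case (Bang t u)
  obtain Q' where Q: "Q = Bang Q'" "u = sem \<tau> Q'" using sem_eq_TBang[OF Bang.prems(2)] by blast
  then have "TPar u (TBang u) = sem \<tau> (Par Q' (Bang Q'))" by simp
  from Bang.IH[OF Bang.prems(1) this] show ?case unfolding Q(1) sem.simps by (rule tle.Bang)
next
  case (Match t u n)
  obtain n' m' Q' where Q: "Q = Match n' m' Q'" "\<tau> n' = \<tau> m'" "u = sem \<tau> Q'"
    using sem_eq_TMatch[OF Match.prems(2)] by metis
  show ?case unfolding Q(1) sem.simps comp_def Q(2)
    by (rule tle.Match) (rule Match.IH[OF Match.prems(1) Q(3), unfolded comp_def])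
qed

section \<open>Unfolding the right-hand side\<close>

text \<open>Mirrors on processes the rules of \<open>tle\<close> that act on the right-hand side
  only. Unfolding commits to nothing: a transition of the unfolded process is one of the whole, by
  \<open>unf_step\<close>.\<close>

inductive unf :: "proc \<Rightarrow> proc \<Rightarrow> bool" where
  "unf P P"
| "unf P R \<Longrightarrow> unf (Sum P Q) R"
| "unf Q R \<Longrightarrow> unf (Sum P Q) R"
| "unf (Par P (Bang P)) R \<Longrightarrow> unf (Bang P) R"
| "unf P R \<Longrightarrow> unf (Match n n P) R"

lemma unf_fn: "unf Q Q' \<Longrightarrow> fn Q' \<subseteq> fn Q"
  by (induction rule: unf.induct) auto

lemma unf_step: "unf Q Q' \<Longrightarrow> step Q' \<alpha> R \<Longrightarrow> step Q \<alpha> R"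
  by (induction rule: unf.induct) (auto intro: step.intros)

lemma unf_tle: "unf Q Q' \<Longrightarrow> tle B t (sem id Q') \<Longrightarrow> tle B t (sem id Q)"
  by (induction rule: unf.induct) (auto intro: tle.intros)

text \<open>The right-hand side is read at \<open>id\<close>, so that a node
  \<open>TMatch n n u\<close> stems from a match of a name with itself, which \<open>unf\<close> may
  pass; another environment could identify distinct names there.\<close>

lemma tle_unfold:
  assumes "tle B t (sem id Q)"
  shows "t \<in> B \<or> (\<exists>Q'. unf Q Q' \<and> cong (tle B) t (sem id Q'))"
proof -
  have "u = sem id Q \<Longrightarrow> t \<in> B \<or> (\<exists>Q'. unf Q Q' \<and> cong (tle B) t (sem id Q'))"
    if "tle B t u" for u Q
    using that
  proof (induction arbitrary: Q)
    case (cong t u)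
    have "cong (tle B) t u" by (rule mp[OF cong_mono cong(1)]) blast
    then show ?case using cong.prems unf.intros(1) by blast
  next
    case (Bang t u)
    obtain Q' where Q: "Q = Bang Q'" "u = sem id Q'"
      using sem_eq_TBang[OF Bang.prems] by blast
    then have "TPar u (TBang u) = sem id (Par Q' (Bang Q'))" by simp
    from Bang.IH[OF this] show ?case unfolding Q(1) using unf.intros(4) by blast
  qed (auto dest!: sem_eq intro: unf.intros, (metis unf.intros)+)
  then show ?thesis using assms by blast
qed

section \<open>Free names along transitions, and renaming of actions\<close>

lemma fn_foldr_Res [simp]: "fn (foldr Res ns P) = fn P - set ns"
  by (induction ns) auto

lemma fn_bind_pat:
  assumes "length bs = length xs"
  shows "bind_pat \<sigma> xs bs ` fn P \<subseteq> \<sigma> ` (fn P - places xs) \<union> set bs"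
  using assms by (auto simp: bind_pat_def override_on_def first_pos_less)

text \<open>Serves two ends: closed processes stay closed under internal steps, and after a
  communication the free names of the residuals are confined to those on which the renamings are
  controlled.\<close>

lemma step_fn:
  "step P \<alpha> P' \<Longrightarrow> (case \<alpha> of
     ATau \<Rightarrow> fn P' \<subseteq> fn P
   | AInp as bs \<Rightarrow> set as \<subseteq> fn P \<and> fn P' \<subseteq> fn P \<union> set bs
   | AOut as ns bs \<Rightarrow> set as \<subseteq> fn P \<and> set bs \<subseteq> fn P \<union> set ns \<and> fn P' \<subseteq> fn P \<union> set ns)"
proof (induction rule: step.induct)
  case (Inp xs bs \<sigma> as P)
  then have \<sigma>: "\<sigma> = bind_pat id xs bs" "length bs = length xs"
    by (auto simp: pat_match_iff) (metis length_canon_pat length_pat_inst)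
  then show ?case using fn_bind_pat[OF \<sigma>(2), of id P] by (auto simp: fn_subst)
next
  case (Alpha P Q \<alpha> Q' P')
  then show ?case by (simp add: fn_alpha[OF Alpha(1)] fn_alpha[OF Alpha(3)] split: action.splits)
next
  case (ParL P \<alpha> P' Q)
  then show ?case by (cases \<alpha>) auto
next
  case (ParR Q \<alpha> Q' P)
  then show ?case by (cases \<alpha>) auto
next
  case (Res P \<alpha> P' n)
  then show ?case by (cases \<alpha>) auto
qed (auto split: action.splits)

fun ren :: "(name \<Rightarrow> name) \<Rightarrow> action \<Rightarrow> action" where
  "ren \<pi> ATau = ATau"
| "ren \<pi> (AInp as bs) = AInp (map \<pi> as) (map \<pi> bs)"
| "ren \<pi> (AOut as ns bs) = AOut (map \<pi> as) (map \<pi> ns) (map \<pi> bs)"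

lemma bn_ren [simp]: "bn (ren \<pi> \<alpha>) = \<pi> ` bn \<alpha>"
  by (cases \<alpha>) auto

lemma names_ren [simp]: "names (ren \<pi> \<alpha>) = \<pi> ` names \<alpha>"
  by (cases \<alpha>) auto

lemma ren_cong: "(\<And>x. x \<in> names \<alpha> \<Longrightarrow> \<pi> x = \<pi>' x) \<Longrightarrow> ren \<pi> \<alpha> = ren \<pi>' \<alpha>"
  by (cases \<alpha>) auto

lemma finite_names [simp]: "finite (names \<alpha>)"
  by (cases \<alpha>) auto

lemma ren_ATau_iff [simp]: "ren \<pi> \<alpha> = ATau \<longleftrightarrow> \<alpha> = ATau"
  by (cases \<alpha>) auto

lemma rename_away:
  fixes \<pi> :: "name \<Rightarrow> name"
  assumes "finite N" "finite A" "finite F" "N \<inter> A = {}" "inj \<pi>"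
  shows "\<exists>\<pi>'. inj \<pi>' \<and> (\<forall>a \<in> A. \<pi>' a = \<pi> a) \<and> \<pi>' ` N \<inter> F = {}"
  using assms(1,4)
proof (induction N)
  case empty
  show ?case using assms(5) by (intro exI[of _ \<pi>]) simp
next
  case (insert n N)
  have "N \<inter> A = {}" using insert.prems by blast
  from insert.IH[OF this] obtain \<pi>1
    where \<pi>1: "inj \<pi>1" "\<forall>a \<in> A. \<pi>1 a = \<pi> a" "\<pi>1 ` N \<inter> F = {}" by (elim exE conjE)
  have "finite (F \<union> \<pi>1 ` A \<union> \<pi>1 ` N)" using insert.hyps(1) assms(2,3) by (intro finite_UnI finite_imageI)
  from ex_new_if_finite[OF infinite_UNIV_nat this]
  obtain z where z: "z \<notin> F \<union> \<pi>1 ` A \<union> \<pi>1 ` N" by (elim exE)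
  \<comment> \<open>The transposition of \<open>\<pi>1 n\<close> and \<open>z\<close>. A mere update
    of \<open>\<pi>1\<close> at \<open>n\<close> could break injectivity, since \<open>z\<close> may
    be a value of \<open>\<pi>1\<close> outside \<open>A\<close> and \<open>N\<close>.\<close>
  define s where "s y = (if y = \<pi>1 n then z else if y = z then \<pi>1 n else y)" for y
  have "inj s" by (rule injI) (simp add: s_def split: if_splits)
  moreover have fixed: "s (\<pi>1 a) = \<pi>1 a" if "a \<in> A \<union> N" for a
  proof -
    have "a \<noteq> n" using that insert.hyps(2) insert.prems by blast
    then have "\<pi>1 a \<noteq> \<pi>1 n" using \<pi>1(1) by (simp add: inj_eq)
    moreover have "\<pi>1 a \<noteq> z" using z that by blast
    ultimately show ?thesis by (simp add: s_def)
  qed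
  moreover have "(s \<circ> \<pi>1) ` insert n N = insert z (\<pi>1 ` N)"
    using fixed by (simp add: s_def[of "\<pi>1 n"] image_comp[symmetric])
  ultimately have "inj (s \<circ> \<pi>1)" "(s \<circ> \<pi>1) ` insert n N \<inter> F = {}"
    using \<pi>1 z by (simp_all add: inj_compose)
  moreover have "\<forall>a \<in> A. (s \<circ> \<pi>1) a = \<pi> a"
  proof
    fix a assume "a \<in> A"
    then show "(s \<circ> \<pi>1) a = \<pi> a" using fixed[of a] \<pi>1(2) by simp
  qed
  ultimately show ?case by blast
qed

lemma disjoint_insertI: "S \<subseteq> insert x G \<Longrightarrow> x \<notin> A \<Longrightarrow> A \<inter> F = {} \<Longrightarrow> G \<subseteq> F \<Longrightarrow> A \<inter> S = {}"
  by blast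

section \<open>The simulation\<close>

text \<open>All that the simulation has to know of holes, stated for every process and environment
  that denote the tree. The instances are the empty set and \<open>dead_trees\<close>.\<close>

locale holes =
  fixes B :: "tree set"
  assumes hole_closed: "sem \<sigma> P \<in> B \<Longrightarrow> fn P = {}"
    and hole_step: "sem \<sigma> P \<in> B \<Longrightarrow> step P \<alpha> P' \<Longrightarrow> \<alpha> = ATau \<and> sem \<sigma> P' \<in> B"
begin

definition simul :: "(name \<Rightarrow> name) \<Rightarrow> action \<Rightarrow> proc \<Rightarrow> proc \<Rightarrow> bool" where
  "simul \<pi> \<alpha> P' Q \<longleftrightarrow>
     (\<exists>Q'. step Q (ren \<pi> \<alpha>) Q' \<and> tle B (sem \<pi> P') (sem id Q')) \<or>
     \<alpha> = ATau \<and> tle B (sem \<pi> P') (sem id Q)"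

lemma tle_sem_comp:
  "tle B (sem \<pi> P) (sem id Q) \<Longrightarrow> tle B (sem (\<rho> \<circ> \<pi>) P) (sem \<rho> Q)"
  using tle_comp[where \<rho> = \<rho> and \<tau> = id, OF _ hole_closed refl refl] by simp

text \<open>Closes the residuals again over names that were restricted: their values under
  \<open>\<pi>'\<close> are overwritten by the new binders, so any \<pi> that agrees with
  \<open>\<pi>'\<close> on the other free names will do.\<close>

lemma tle_foldr_Res:
  assumes "tle B (sem \<pi>' P) (sem id Q)" "inj \<pi>'" "\<And>x. x \<in> fn P - set ns \<Longrightarrow> \<pi> x = \<pi>' x"
  shows "tle B (sem \<pi> (foldr Res ns P)) (sem id (foldr Res (map \<pi>' ns) Q))"
proof -
  \<comment> \<open>Generalised to all \<rho>, since each restriction that is passed updates the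
    environments of both sides; by injectivity of \<open>\<pi>'\<close>, the update at
    \<open>\<pi>' n\<close> concerns \<open>n\<close> alone.\<close>
  have "tle B (sem (\<rho> \<circ> \<pi>) (foldr Res ns P)) (sem \<rho> (foldr Res (map \<pi>' ns) Q))" for \<rho>
    using assms(3)
  proof (induction ns arbitrary: \<pi> \<rho>)
    case Nil
    have "sem (\<rho> \<circ> \<pi>) P = sem (\<rho> \<circ> \<pi>') P" using Nil by (intro sem_cong) auto
    then show ?case using tle_sem_comp[OF assms(1)] by (simp only: foldr.simps list.map id_apply)
  next
    case (Cons n ns)
    have "tle B (sem ((\<rho> \<circ> \<pi>)(n := m)) (foldr Res ns P))
      (sem (\<rho>(\<pi>' n := m)) (foldr Res (map \<pi>' ns) Q))" for m
    proof -
      have "tle B (sem (\<rho>(\<pi>' n := m) \<circ> \<pi>(n := \<pi>' n)) (foldr Res ns P))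
        (sem (\<rho>(\<pi>' n := m)) (foldr Res (map \<pi>' ns) Q))"
        using Cons(2) by (intro Cons(1)) auto
      moreover have "sem (\<rho>(\<pi>' n := m) \<circ> \<pi>(n := \<pi>' n)) (foldr Res ns P)
        = sem ((\<rho> \<circ> \<pi>)(n := m)) (foldr Res ns P)"
        using Cons(2) assms(2) by (intro sem_cong) (auto simp: inj_eq)
      ultimately show ?thesis by simp
    qed
    moreover have "foldr Res (k # ks) X = Res k (foldr Res ks X)" for k ks X by simp
    ultimately show ?case
      unfolding list.map by (simp only: sem.simps) (rule tle.cong, rule cong.intros(7))
  qed
  from this[of id] show ?thesis by simp
qed

text \<open>
  The target is renamed by a second renaming: an extruded name may also occur free in a summand
  or a match that is discarded by the transition, so the two renamings differ there.
\<close>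

lemma simul_head:
  assumes "tle B (sem \<pi> P) (sem id Q)" "step P \<alpha> P'"
    and "\<And>Q0. fn Q0 \<subseteq> fn Q \<Longrightarrow> cong (tle B) (sem \<pi> P) (sem id Q0) \<Longrightarrow> simul \<pi>' \<alpha> P' Q0"
  shows "simul \<pi>' \<alpha> P' Q"
proof (cases "sem \<pi> P \<in> B")
  case True
  then have P': "\<alpha> = ATau" "sem \<pi> P' \<in> B" using hole_step assms(2) by blast+
  have "sem \<pi>' P' = sem \<pi> P'" using hole_closed[OF P'(2)] by (intro sem_cong) simp
  then show ?thesis using P' by (auto simp: simul_def intro: tle.hole)
next
  case False
  then obtain Q0 where Q0: "unf Q Q0" "cong (tle B) (sem \<pi> P) (sem id Q0)"
    using tle_unfold[OF assms(1)] by blast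
  from assms(3)[OF unf_fn[OF Q0(1)] Q0(2)] show ?thesis
    using unf_step[OF Q0(1)] unf_tle[OF Q0(1)] unfolding simul_def by blast
qed

lemma simul_alpha:
  assumes "Q \<equiv>\<^sub>\<alpha> R" "simul \<pi> \<alpha> P' R"
  shows "simul \<pi> \<alpha> P' Q"
  using assms sem_alpha[OF assms(1), of id] unfolding simul_def
  by (metis step.Alpha alpha_refl)

lemma simul_visible:
  "simul \<pi> \<alpha> P' Q \<Longrightarrow> \<alpha> \<noteq> ATau \<Longrightarrow> \<exists>Q'. step Q (ren \<pi> \<alpha>) Q' \<and> tle B (sem \<pi> P') (sem id Q')"
  by (simp add: simul_def)

lemma tle_Par:
  "tle B (sem \<pi> P) (sem id Q) \<Longrightarrow> tle B (sem \<pi> P') (sem id Q') \<Longrightarrow>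
   tle B (sem \<pi> (Par P P')) (sem id (Par Q Q'))"
  by (auto intro: tle.cong cong.intros)

text \<open>The claim of \<open>simulation\<close> for a single transition, named so that the two
  communication rules can share \<open>simul_Com\<close>.\<close>

definition simulates :: "proc \<Rightarrow> action \<Rightarrow> proc \<Rightarrow> bool" where
  "simulates P \<alpha> P' \<longleftrightarrow> (\<forall>\<pi> \<pi>' Q. inj \<pi>' \<longrightarrow> (\<forall>x \<in> fn P - bn \<alpha>. \<pi>' x = \<pi> x) \<longrightarrow>
     tle B (sem \<pi> P) (sem id Q) \<longrightarrow> \<pi>' ` bn \<alpha> \<inter> fn Q = {} \<longrightarrow> simul \<pi>' \<alpha> P' Q)"

lemma simulatesD:
  "simulates P \<alpha> P' \<Longrightarrow> inj \<pi>' \<Longrightarrow> (\<And>x. x \<in> fn P - bn \<alpha> \<Longrightarrow> \<pi>' x = \<pi> x) \<Longrightarrow>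
   tle B (sem \<pi> P) (sem id Q) \<Longrightarrow> \<pi>' ` bn \<alpha> \<inter> fn Q = {} \<Longrightarrow> simul \<pi>' \<alpha> P' Q"
  unfolding simulates_def by blast

lemma simul_Com:
  assumes step: "step P \<alpha> P'" "step R \<beta> R'"
    and \<alpha>: "\<alpha> = AInp as bs \<and> \<beta> = AOut as ns bs \<and> set ns \<inter> fn P = {} \<or>
      \<alpha> = AOut as ns bs \<and> \<beta> = AInp as bs \<and> set ns \<inter> fn R = {}"
    and IH: "simulates P \<alpha> P'" "simulates R \<beta> R'"
    and \<pi>: "inj \<pi>'" "\<And>x. x \<in> fn P \<union> fn R \<Longrightarrow> \<pi>' x = \<pi> x"
    and c: "cong (tle B) (sem \<pi> (Par P R)) (sem id Q)"
  shows "simul \<pi>' ATau (foldr Res ns (Par P' R')) Q"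
proof -
  obtain Q1 Q2 where Q: "Q = Par Q1 Q2" "tle B (sem \<pi> P) (sem id Q1)" "tle B (sem \<pi> R) (sem id Q2)"
    using c by (auto elim!: cong_TParE dest!: sem_eq_TPar[OF sym])
  \<comment> \<open>\<open>ns\<close> is left out because the sender may still have such a name
    free, in a part that the transition discards. On all other free names the new renaming has to
    follow \<open>\<pi>'\<close>.\<close>
  let ?A = "fn P \<union> fn R - set ns"
  have "\<exists>\<pi>2. inj \<pi>2 \<and> (\<forall>a \<in> ?A. \<pi>2 a = \<pi>' a) \<and> \<pi>2 ` set ns \<inter> fn Q = {}"
    by (rule rename_away) (use \<pi>(1) in auto)
  then obtain \<pi>2 where \<pi>2: "inj \<pi>2" "\<forall>a \<in> ?A. \<pi>2 a = \<pi>' a" "\<pi>2 ` set ns \<inter> fn Q = {}"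
    by (elim exE conjE)
  have fresh: "\<pi>2 ` set ns \<inter> fn Q1 = {}" "\<pi>2 ` set ns \<inter> fn Q2 = {}"
    using \<pi>2(3) Q(1) by auto
  have "simul \<pi>2 \<alpha> P' Q1"
    by (rule simulatesD[OF IH(1) \<pi>2(1) _ Q(2)]) (use \<alpha> \<pi>2(2) \<pi>(2) fresh in \<open>elim disjE; force\<close>)+
  moreover have "simul \<pi>2 \<beta> R' Q2"
    by (rule simulatesD[OF IH(2) \<pi>2(1) _ Q(3)]) (use \<alpha> \<pi>2(2) \<pi>(2) fresh in \<open>elim disjE; force\<close>)+
  moreover have "\<alpha> \<noteq> ATau" "\<beta> \<noteq> ATau" using \<alpha> by auto
  ultimately obtain Q1' Q2' where Q': "step Q1 (ren \<pi>2 \<alpha>) Q1'" "tle B (sem \<pi>2 P') (sem id Q1')"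
    "step Q2 (ren \<pi>2 \<beta>) Q2'" "tle B (sem \<pi>2 R') (sem id Q2')"
    using simul_visible by blast
  have "set (map \<pi>2 ns) \<inter> fn Q1 = {}" "set (map \<pi>2 ns) \<inter> fn Q2 = {}"
    using fresh by simp_all
  then have "step Q ATau (foldr Res (map \<pi>2 ns) (Par Q1' Q2'))"
    using Q'(1,3) \<alpha> step.ComL step.ComR unfolding Q(1) by (metis ren.simps(2,3))
  moreover have "fn (Par P' R') \<subseteq> fn P \<union> fn R \<union> set ns"
    using step_fn[OF step(1)] step_fn[OF step(2)] \<alpha> by (elim disjE) (simp, blast)+
  then have "tle B (sem \<pi>' (foldr Res ns (Par P' R'))) (sem id (foldr Res (map \<pi>2 ns) (Par Q1' Q2')))"
    using \<pi>2(2) by (intro tle_foldr_Res tle_Par Q' \<pi>2) (metis DiffD1 DiffD2 DiffI UnE subsetD)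
  ultimately show ?thesis unfolding simul_def ren.simps by blast
qed

lemma cong_Res_inst:
  assumes "cong (tle B) (sem \<pi> (Res n P)) (sem id (Res k Q))"
  shows "tle B (sem (\<pi>(n := m)) P) (sem id (subst (id(k := m)) Q))"
proof -
  have "tle B (sem (\<pi>(n := m)) P) (sem (id(k := m)) Q)"
    using assms by (auto elim!: cong_TResE)
  then show ?thesis unfolding sem_subst by (simp only: id_comp)
qed

text \<open>Induction on the transition of the left-hand side. \<open>simul_head\<close> settles
  holes and unfoldings, so each constructor only meets a right-hand side whose tree has the same top
  node.\<close>

lemma simulation:
  "step P \<alpha> P' \<Longrightarrow> inj \<pi>' \<Longrightarrow> (\<And>x. x \<in> fn P - bn \<alpha> \<Longrightarrow> \<pi>' x = \<pi> x) \<Longrightarrow>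
   tle B (sem \<pi> P) (sem id Q) \<Longrightarrow> \<pi>' ` bn \<alpha> \<inter> fn Q = {} \<Longrightarrow> simul \<pi>' \<alpha> P' Q"
proof (induction arbitrary: \<pi> \<pi>' Q rule: step.induct)
  case (Tau P)
  have P: "sem \<pi> (Pre Tau P) = sem \<pi>' (Pre Tau P)" using Tau(2) by (intro sem_cong) simp
  show ?case
  proof (rule simul_head[OF Tau(3) step.Tau])
    fix Q0 assume "cong (tle B) (sem \<pi> (Pre Tau P)) (sem id Q0)"
    then obtain Q1 where Q: "Q0 = Pre Tau Q1" "tle B (sem \<pi>' P) (sem id Q1)"
      unfolding P by (auto elim!: cong_TTauE dest!: sem_eq_TTau[OF sym])
    then show "simul \<pi>' ATau P Q0" unfolding simul_def Q(1) ren.simps using step.Tau by blast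
  qed
next
  case (Inp xs bs \<sigma> as P)
  have P: "sem \<pi> (Pre (Inp as xs) P) = sem \<pi>' (Pre (Inp as xs) P)" using Inp(3) by (intro sem_cong) simp
  show ?case
  proof (rule simul_head[OF Inp(4) step.Inp[OF Inp(1)]])
    fix Q0 assume "cong (tle B) (sem \<pi> (Pre (Inp as xs) P)) (sem id Q0)"
    then obtain as' ys Q1 where Q: "Q0 = Pre (Inp as' ys) Q1" "map \<pi>' as = as'"
      "canon_pat \<pi>' xs = canon_pat id ys"
      and t: "\<And>bs. length bs = length ys \<Longrightarrow> tle B (sem (bind_pat \<pi>' xs bs) P) (sem (bind_pat id ys bs) Q1)"
      unfolding P by (auto elim!: cong_TInpE dest!: sem_eq_TInp[OF sym])
    have bs: "\<sigma> = bind_pat id xs bs" "pat_inst (nth bs) (canon_pat id xs) = bs"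
      using Inp(1) by (auto simp: pat_match_iff)
    then have len: "length bs = length xs" by (metis length_canon_pat length_pat_inst)
    have "step Q0 (ren \<pi>' (AInp as bs)) (subst (bind_pat id ys (map \<pi>' bs)) Q1)"
      using pat_inst_canon_map[OF bs(2), of \<pi>'] unfolding Q(1) Q(2)[symmetric] Q(3) ren.simps
      by (intro step.Inp) (simp add: pat_match_iff)
    moreover have "sem \<pi>' (subst \<sigma> P) = sem (bind_pat \<pi>' xs (map \<pi>' bs)) P"
      unfolding sem_subst bs(1)
      by (rule sem_cong) (auto simp: bind_pat_def override_on_def len first_pos_less)
    moreover have "sem id (subst (bind_pat id ys (map \<pi>' bs)) Q1) = sem (bind_pat id ys (map \<pi>' bs)) Q1"
      unfolding sem_subst id_comp ..
    moreover have "length (map \<pi>' bs) = length ys"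
      using len Q(3) by (metis length_canon_pat length_map)
    ultimately show "simul \<pi>' (AInp as bs) (subst \<sigma> P) Q0"
      using t[of "map \<pi>' bs"] unfolding simul_def by metis
  qed
next
  case (Out as bs P)
  have P: "sem \<pi> (Pre (Out as bs) P) = sem \<pi>' (Pre (Out as bs) P)" using Out(2) by (intro sem_cong) simp
  show ?case
  proof (rule simul_head[OF Out(3) step.Out])
    fix Q0 assume "cong (tle B) (sem \<pi> (Pre (Out as bs) P)) (sem id Q0)"
    then obtain Q1 where Q: "Q0 = Pre (Out (map \<pi>' as) (map \<pi>' bs)) Q1" "tle B (sem \<pi>' P) (sem id Q1)"
      unfolding P by (auto elim!: cong_TOutE dest!: sem_eq_TOut[OF sym])
    then show "simul \<pi>' (AOut as [] bs) P Q0"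
      unfolding simul_def Q(1) ren.simps list.map using step.Out by blast
  qed
next
  case (SumL P \<alpha> P' R)
  show ?case
  proof (rule simul_head[OF SumL(5) step.SumL[OF SumL(1)]])
    fix Q0 assume fn: "fn Q0 \<subseteq> fn Q" and "cong (tle B) (sem \<pi> (Sum P R)) (sem id Q0)"
    then obtain Q1 Q2 where Q: "Q0 = Sum Q1 Q2" "tle B (sem \<pi> P) (sem id Q1)"
      by (auto elim!: cong_TSumE dest!: sem_eq_TSum[OF sym])
    then have "simul \<pi>' \<alpha> P' Q1" using SumL(4,6) fn by (intro SumL(2)[OF SumL(3) _ Q(2)]) auto
    then show "simul \<pi>' \<alpha> P' Q0"
      unfolding simul_def Q(1) sem.simps using step.SumL tle.SumL by blast
  qed
next
  case (SumR R \<alpha> R' P)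
  show ?case
  proof (rule simul_head[OF SumR(5) step.SumR[OF SumR(1)]])
    fix Q0 assume fn: "fn Q0 \<subseteq> fn Q" and "cong (tle B) (sem \<pi> (Sum P R)) (sem id Q0)"
    then obtain Q1 Q2 where Q: "Q0 = Sum Q1 Q2" "tle B (sem \<pi> R) (sem id Q2)"
      by (auto elim!: cong_TSumE dest!: sem_eq_TSum[OF sym])
    then have "simul \<pi>' \<alpha> R' Q2" using SumR(4,6) fn by (intro SumR(2)[OF SumR(3) _ Q(2)]) auto
    then show "simul \<pi>' \<alpha> R' Q0"
      unfolding simul_def Q(1) sem.simps using step.SumR tle.SumR by blast
  qed
next
  case (ParL P \<alpha> P' R)
  have o: "sem \<pi> R = sem \<pi>' R" using ParL(2) by (intro sem_cong sym[OF ParL(5)]) auto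
  show ?case
  proof (rule simul_head[OF ParL(6) step.ParL[OF ParL(1,2)]])
    fix Q0 assume fn: "fn Q0 \<subseteq> fn Q" and "cong (tle B) (sem \<pi> (Par P R)) (sem id Q0)"
    then obtain Q1 Q2 where Q: "Q0 = Par Q1 Q2" "tle B (sem \<pi> P) (sem id Q1)" "tle B (sem \<pi> R) (sem id Q2)"
      by (auto elim!: cong_TParE dest!: sem_eq_TPar[OF sym])
    then have "simul \<pi>' \<alpha> P' Q1" using ParL(5,7) fn by (intro ParL(3)[OF ParL(4) _ Q(2)]) auto
    moreover have "bn (ren \<pi>' \<alpha>) \<inter> fn Q2 = {}" using ParL(7) fn Q(1) by auto
    ultimately show "simul \<pi>' \<alpha> (Par P' R) Q0"
      unfolding simul_def Q(1) using tle_Par[OF _ Q(3)[unfolded o]] step.ParL by blast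
  qed
next
  case (ParR R \<alpha> R' P)
  have o: "sem \<pi> P = sem \<pi>' P" using ParR(2) by (intro sem_cong sym[OF ParR(5)]) auto
  show ?case
  proof (rule simul_head[OF ParR(6) step.ParR[OF ParR(1,2)]])
    fix Q0 assume fn: "fn Q0 \<subseteq> fn Q" and "cong (tle B) (sem \<pi> (Par P R)) (sem id Q0)"
    then obtain Q1 Q2 where Q: "Q0 = Par Q1 Q2" "tle B (sem \<pi> P) (sem id Q1)" "tle B (sem \<pi> R) (sem id Q2)"
      by (auto elim!: cong_TParE dest!: sem_eq_TPar[OF sym])
    then have "simul \<pi>' \<alpha> R' Q2" using ParR(5,7) fn by (intro ParR(3)[OF ParR(4) _ Q(3)]) auto
    moreover have "bn (ren \<pi>' \<alpha>) \<inter> fn Q1 = {}" using ParR(7) fn Q(1) by auto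
    ultimately show "simul \<pi>' \<alpha> (Par P R') Q0"
      unfolding simul_def Q(1) using tle_Par[OF Q(2)[unfolded o]] step.ParR by blast
  qed
next
  case (ComL P as bs P' R ns R')
  have IH: "simulates P (AInp as bs) P'" "simulates R (AOut as ns bs) R'"
    unfolding simulates_def
    by (intro allI impI, rule ComL(4)[rotated 2], assumption, assumption, assumption, erule (1) bspec)
      (intro allI impI, rule ComL(5)[rotated 2], assumption, assumption, assumption, erule (1) bspec)
  show ?case
  proof (rule simul_head[OF ComL(8) step.ComL[OF ComL(1-3)]])
    fix Q0 assume c: "cong (tle B) (sem \<pi> (Par P R)) (sem id Q0)"
    show "simul \<pi>' ATau (foldr Res ns (Par P' R')) Q0"
    proof (rule simul_Com[where as = as and bs = bs, OF ComL(1,2) _ IH ComL(6) _ c])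
      show "\<pi>' x = \<pi> x" if "x \<in> fn P \<union> fn R" for x
        by (rule ComL(7)) (use that in simp)
    qed (simp add: ComL(3))
  qed
next
  case (ComR P as ns bs P' R R')
  have IH: "simulates P (AOut as ns bs) P'" "simulates R (AInp as bs) R'"
    unfolding simulates_def
    by (intro allI impI, rule ComR(4)[rotated 2], assumption, assumption, assumption, erule (1) bspec)
      (intro allI impI, rule ComR(5)[rotated 2], assumption, assumption, assumption, erule (1) bspec)
  show ?case
  proof (rule simul_head[OF ComR(8) step.ComR[OF ComR(1-3)]])
    fix Q0 assume c: "cong (tle B) (sem \<pi> (Par P R)) (sem id Q0)"
    show "simul \<pi>' ATau (foldr Res ns (Par P' R')) Q0"
    proof (rule simul_Com[where as = as and bs = bs, OF ComR(1,2) _ IH ComR(6) _ c])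
      show "\<pi>' x = \<pi> x" if "x \<in> fn P \<union> fn R" for x
        by (rule ComR(7)) (use that in simp)
    qed (simp add: ComR(3))
  qed
next
  case (Res P \<alpha> P' n)
  show ?case
  proof (rule simul_head[OF Res(6) step.Res[OF Res(1,2)]])
    fix Q0 assume fn: "fn Q0 \<subseteq> fn Q" and c: "cong (tle B) (sem \<pi> (Res n P)) (sem id Q0)"
    then obtain k Q1 where Q: "Q0 = Res k Q1" by (auto elim!: cong_TResE dest!: sem_eq_TRes[OF sym])
    \<comment> \<open>\<open>n\<close> will be sent to a name that is fresh for \<open>Q0\<close>,
      so that the restriction on the right can be alpha-converted to it; the names visible outside
      the restriction keep their values under \<open>\<pi>'\<close>.\<close>
    let ?A = "(fn P \<union> names \<alpha> \<union> fn P') - {n}"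
    have "\<exists>\<pi>2. inj \<pi>2 \<and> (\<forall>a \<in> ?A. \<pi>2 a = \<pi>' a) \<and> \<pi>2 ` {n} \<inter> fn Q0 = {}"
      by (rule rename_away) (use Res(4) in simp_all)
    then obtain \<pi>2 where \<pi>2: "inj \<pi>2" "\<forall>a \<in> ?A. \<pi>2 a = \<pi>' a" "\<pi>2 ` {n} \<inter> fn Q0 = {}"
      by (elim exE conjE)
    define Q1' where "Q1' = subst (id(k := \<pi>2 n)) Q1"
    have \<alpha>: "Q0 \<equiv>\<^sub>\<alpha> Res (\<pi>2 n) Q1'"
      unfolding Q Q1'_def using \<pi>2(3) Q by (intro alpha_conv_Res) simp
    have t: "tle B (sem (\<pi>(n := \<pi>2 n)) P) (sem id Q1')"
      using c unfolding Q Q1'_def by (rule cong_Res_inst)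
    have bn: "bn \<alpha> \<subseteq> names \<alpha>" by (cases \<alpha>) auto
    have bn2: "\<pi>2 ` bn \<alpha> = \<pi>' ` bn \<alpha>" using \<pi>2(2) Res(2) bn by (intro image_cong) auto
    have n: "\<pi>2 n \<notin> names (ren \<pi>2 \<alpha>)" using \<pi>2(1) Res(2) by (simp add: inj_image_mem_iff)
    have "fn Q1' \<subseteq> insert (\<pi>2 n) (fn Q0)"
      unfolding Q1'_def Q by (auto simp: fn_subst)
    moreover have "\<pi>2 n \<notin> \<pi>2 ` bn \<alpha>" using n bn by auto
    moreover have "\<pi>2 ` bn \<alpha> \<inter> fn Q = {}" unfolding bn2 by (rule Res(7))
    ultimately have fresh: "\<pi>2 ` bn \<alpha> \<inter> fn Q1' = {}" using fn by (rule disjoint_insertI)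
    have "simul \<pi>2 \<alpha> P' Q1'"
    proof (rule Res(3)[OF \<pi>2(1) _ t fresh])
      fix x assume "x \<in> fn P - bn \<alpha>"
      then show "\<pi>2 x = (\<pi>(n := \<pi>2 n)) x" using Res(5)[of x] \<pi>2(2) by (cases "x = n") simp_all
    qed
    moreover have "ren \<pi>2 \<alpha> = ren \<pi>' \<alpha>" using \<pi>2(2) Res(2) by (intro ren_cong) auto
    moreover have "tle B (sem \<pi>' (Res n P')) (sem id (Res (\<pi>2 n) Q'))"
      if "tle B (sem \<pi>2 P') (sem id Q')" for Q'
      using tle_foldr_Res[OF that \<pi>2(1), of "[n]" \<pi>'] \<pi>2(2) by simp
    moreover have "step (Res (\<pi>2 n) Q1') (ren \<pi>2 \<alpha>) (Res (\<pi>2 n) Q')"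
      if "step Q1' (ren \<pi>2 \<alpha>) Q'" for Q'
      using that n by (rule step.Res)
    ultimately have "simul \<pi>' \<alpha> (Res n P') (Res (\<pi>2 n) Q1')"
      unfolding simul_def by (auto simp del: sem.simps)
    then show "simul \<pi>' \<alpha> (Res n P') Q0" using \<alpha> simul_alpha by blast
  qed
next
  case (Open P as ns bs P' n)
  show ?case
  proof (rule simul_head[OF Open(7) step.Open[OF Open(1-3)]])
    fix Q0 assume fn: "fn Q0 \<subseteq> fn Q" and c: "cong (tle B) (sem \<pi> (Res n P)) (sem id Q0)"
    then obtain k Q1 where Q: "Q0 = Res k Q1" by (auto elim!: cong_TResE dest!: sem_eq_TRes[OF sym])
    \<comment> \<open>Here \<open>n\<close> is among the extruded names of the action, so
      \<open>\<pi>' n\<close> is fresh for \<open>Q\<close> by assumption and can serve as the bound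
      name on the right.\<close>
    define Q1' where "Q1' = subst (id(k := \<pi>' n)) Q1"
    have \<alpha>: "Q0 \<equiv>\<^sub>\<alpha> Res (\<pi>' n) Q1'"
      unfolding Q Q1'_def using Open(8) fn Q by (intro alpha_conv_Res) auto
    have t: "tle B (sem (\<pi>(n := \<pi>' n)) P) (sem id Q1')"
      using c unfolding Q Q1'_def by (rule cong_Res_inst)
    have fn1: "fn Q1' \<subseteq> insert (\<pi>' n) (fn Q0)"
      unfolding Q1'_def Q by (auto simp: fn_subst)
    have n: "\<pi>' n \<notin> set (map \<pi>' as) \<union> set (map \<pi>' ns)"
      using Open(3,5) by (auto simp: inj_eq)
    have "\<pi>' ` bn (AOut as ns bs) \<inter> fn Q1' = {}"
      by (rule disjoint_insertI[OF fn1 _ _ fn]) (use Open(8) n in simp_all)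
    then have "simul \<pi>' (AOut as ns bs) P' Q1'"
      using Open(6) by (intro Open(4)[OF Open(5) _ t]) auto
    then obtain Q' where Q': "step Q1' (ren \<pi>' (AOut as ns bs)) Q'" "tle B (sem \<pi>' P') (sem id Q')"
      using simul_visible by blast
    have "step (Res (\<pi>' n) Q1') (ren \<pi>' (AOut as (n # ns) bs)) Q'"
      unfolding ren.simps list.map by (rule step.Open) (use Q'(1) n Open(2) in auto)
    then have "simul \<pi>' (AOut as (n # ns) bs) P' (Res (\<pi>' n) Q1')"
      using Q'(2) unfolding simul_def by blast
    then show "simul \<pi>' (AOut as (n # ns) bs) P' Q0" using \<alpha> simul_alpha by blast
  qed
next
  case (Bang P \<alpha> P')
  show ?case
  proof (rule simul_head[OF Bang(5) step.Bang[OF Bang(1)]])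
    fix Q0 assume fn: "fn Q0 \<subseteq> fn Q" and c: "cong (tle B) (sem \<pi> (Bang P)) (sem id Q0)"
    then obtain Q1 where Q: "Q0 = Bang Q1" "tle B (sem \<pi> P) (sem id Q1)"
      by (auto elim!: cong_TBangE dest!: sem_eq_TBang[OF sym])
    \<comment> \<open>The premise concerns the unfolded replication; if it is answered by staying
      put, \<open>tle.Bang\<close> folds the right-hand side back.\<close>
    have t: "tle B (sem \<pi> (Par P (Bang P))) (sem id (Par Q1 (Bang Q1)))"
      using tle_Par[OF Q(2) tle.cong[OF c]] unfolding Q(1) .
    have "simul \<pi>' \<alpha> P' (Par Q1 (Bang Q1))"
      using Bang(4,6) fn Q(1) by (intro Bang(2)[OF Bang(3) _ t]) auto
    then show "simul \<pi>' \<alpha> P' Q0"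
      unfolding simul_def Q(1) sem.simps using step.Bang tle.Bang by blast
  qed
next
  case (Match P \<alpha> P' n)
  show ?case
  proof (rule simul_head[OF Match(5) step.Match[OF Match(1)]])
    fix Q0 assume fn: "fn Q0 \<subseteq> fn Q" and c: "cong (tle B) (sem \<pi> (Match n n P)) (sem id Q0)"
    then obtain Q1 where Q: "Q0 = Match (\<pi> n) (\<pi> n) Q1" "tle B (sem \<pi> P) (sem id Q1)"
      by (auto elim!: cong_TMatchE dest!: sem_eq_TMatch[OF sym])
    then have "simul \<pi>' \<alpha> P' Q1"
      using Match(4,6) fn by (intro Match(2)[OF Match(3) _ Q(2)]) auto
    then show "simul \<pi>' \<alpha> P' Q0"
      unfolding simul_def Q(1) sem.simps using step.Match tle.Match by blast
  qed
next
  case (Alpha P P1 \<alpha> P1' P')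
  have "simul \<pi>' \<alpha> P1' Q"
    using Alpha(6-8) fn_alpha[OF Alpha(1)] sem_alpha[OF Alpha(1)]
    by (intro Alpha(4)[OF Alpha(5)]) auto
  then show ?case using sem_alpha[OF Alpha(3)] unfolding simul_def by simp
qed

lemma weak_simulation:
  assumes "weak P P'" "tle B (sem id P) (sem id Q)"
  shows "\<exists>Q'. weak Q Q' \<and> tle B (sem id P') (sem id Q')"
  using assms unfolding weak_def
proof (induction rule: rtranclp_induct)
  case base
  then show ?case by blast
next
  case (step P1 P2)
  then obtain Q1 where Q1: "(\<lambda>P Q. step P ATau Q)\<^sup>*\<^sup>* Q Q1" "tle B (sem id P1) (sem id Q1)" by blast
  have "simul id ATau P2 Q1" by (rule simulation[OF step(2) _ _ Q1(2)]) auto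
  then consider Q2 where "Defs.step Q1 ATau Q2" "tle B (sem id P2) (sem id Q2)"
    | "tle B (sem id P2) (sem id Q1)"
    unfolding simul_def ren.simps by blast
  then show ?case
  proof cases
    case 1
    then show ?thesis using rtranclp.rtrancl_into_rtrancl[OF Q1(1)] by blast
  next
    case 2
    then show ?thesis using Q1(1) by blast
  qed
qed

lemma may_act_mono:
  assumes "tle B (sem id P) (sem id Q)" "P \<Down>"
  shows "Q \<Down>"
proof -
  obtain \<alpha> P1 P2 where P: "visible \<alpha>" "weak P P1" "step P1 \<alpha> P2"
    using assms(2) unfolding may_act_def by blast
  obtain Q1 where Q1: "weak Q Q1" "tle B (sem id P1) (sem id Q1)"
    using weak_simulation[OF P(2) assms(1)] by blast
  \<comment> \<open>The names extruded by the visible action are moved off \<open>Q1\<close>, and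
    the other free names of \<open>P1\<close> are kept; renaming does not affect visibility.\<close>
  have "\<exists>\<pi>. inj \<pi> \<and> (\<forall>a \<in> fn P1 - bn \<alpha>. \<pi> a = id a) \<and> \<pi> ` bn \<alpha> \<inter> fn Q1 = {}"
    by (rule rename_away) (cases \<alpha>; auto)+
  then obtain \<pi> where \<pi>: "inj \<pi>" "\<forall>a \<in> fn P1 - bn \<alpha>. \<pi> a = id a" "\<pi> ` bn \<alpha> \<inter> fn Q1 = {}"
    by (elim exE conjE)
  have "simul \<pi> \<alpha> P2 Q1"
    by (rule simulation[OF P(3) \<pi>(1) _ Q1(2) \<pi>(3)]) (use \<pi>(2) in blast)
  then obtain Q2 where "step Q1 (ren \<pi> \<alpha>) Q2"
    using P(1) unfolding simul_def visible_def by blast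
  moreover have "visible (ren \<pi> \<alpha>)" using P(1) by (simp add: visible_def)
  moreover have "weak Q2 Q2" by (simp add: weak_def)
  ultimately show ?thesis unfolding may_act_def using Q1(1) by blast
qed

end

text \<open>Equal trees are related by \<open>tle\<close> even without holes. This has to precede
  the use of \<open>dead_trees\<close>, whose locale assumptions rest on it.\<close>

lemma may_act_sem:
  assumes "sem id P = sem id Q" "P \<Down>"
  shows "Q \<Down>"
proof -
  interpret holes "{}" by standard auto
  show ?thesis using may_act_mono[OF _ assms(2)] tle_refl assms(1) by metis
qed

section \<open>Replacement freeness\<close>

text \<open>Fixing \<open>id\<close> loses nothing, since the tree of a closed process does not
  depend on the environment.\<close>

definition dead_trees :: "tree set" where
  "dead_trees = {sem id I | I. fn I = {} \<and> invisible I}"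

lemma dead_trees_sem:
  assumes "sem \<sigma> P \<in> dead_trees"
  shows "fn P = {}" "invisible P"
proof -
  obtain I where I: "sem \<sigma> P = sem id I" "fn I = {}" "invisible I"
    using assms unfolding dead_trees_def by blast
  show P: "fn P = {}" using arg_cong[OF I(1), of tfn] I(2) by (simp add: tfn_sem)
  have "sem id P = sem \<sigma> P" using P by (intro sem_cong) simp
  then show "invisible P" using may_act_sem[of P I] I unfolding invisible_def by metis
qed

lemma dead_treesI: "fn P = {} \<Longrightarrow> invisible P \<Longrightarrow> sem \<sigma> P \<in> dead_trees"
  unfolding dead_trees_def by (smt (verit) empty_iff mem_Collect_eq sem_cong)

lemma step_may_act:
  assumes "step P \<alpha> P'" "visible \<alpha>"
  shows "P \<Down>"
  unfolding may_act_def using assms by (metis weak_def rtranclp.rtrancl_refl)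

lemma tau_may_act: "step P ATau P' \<Longrightarrow> P' \<Down> \<Longrightarrow> P \<Down>"
  unfolding may_act_def weak_def by (metis (mono_tags, lifting) converse_rtranclp_into_rtranclp)

interpretation dead: holes dead_trees
proof
  show "fn P = {}" if "sem \<sigma> P \<in> dead_trees" for \<sigma> P
    using dead_trees_sem(1)[OF that] .
  show "\<alpha> = ATau \<and> sem \<sigma> P' \<in> dead_trees"
    if t: "sem \<sigma> P \<in> dead_trees" and s: "step P \<alpha> P'" for \<sigma> P \<alpha> P'
  proof -
    have P: "fn P = {}" "invisible P" using dead_trees_sem[OF t] by auto
    have \<alpha>: "\<alpha> = ATau" using step_may_act[OF s] P(2) unfolding invisible_def visible_def by blast
    have "fn P' = {}" using step_fn[OF s] P(1) \<alpha> by simp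
    moreover have "invisible P'" using tau_may_act s \<alpha> P(2) unfolding invisible_def by blast
    ultimately show ?thesis using \<alpha> dead_treesI by blast
  qed
qed

text \<open>Binders of \<open>C\<close> change the environment in which the hole is read, hence the
  assumption for every \<sigma>. The rule \<open>hole\<close> accepts any tree on the right,
  whatever \<open>C\<close> captures in \<open>P\<close>.\<close>

lemma tle_fill:
  assumes "\<And>\<sigma>. sem \<sigma> I \<in> B"
  shows "tle B (sem \<sigma> (fill C I)) (sem \<sigma> (fill C P))"
proof (induction C arbitrary: \<sigma>)
  case Hole
  then show ?case using assms by (simp add: tle.hole)
next
  case (CPre \<mu> C)
  show ?case
  proof (cases \<mu>)
    case (Inp as xs)
    show ?thesis unfolding Inp fill.simps sem.simps by (intro tle.cong cong.intros(3) CPre)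
  qed (simp_all add: tle.cong cong.intros CPre)
next
  case (CRes n C)
  then show ?case by (simp add: tle.cong cong.intros)
qed (simp_all add: tle.cong cong.intros tle_refl)

lemma replacement_free: "replacement_free"
  unfolding replacement_free_def closed_proc_def
proof (intro allI impI)
  fix C I P assume I: "fn I = {} \<and> invisible I" and C: "fill C I \<Down>"
  show "fill C P \<Down>"
    by (rule dead.may_act_mono[OF tle_fill C]) (use I in \<open>simp add: dead_treesI\<close>)
qed

section \<open>Failure of strong replacement freeness\<close>

text \<open>An invariant that implies invisibility when \<open>N\<close> is empty: \<open>N\<close>
  collects the restricted names in scope, and every subject, also in continuations, has to contain
  one of them. Inputs do not enlarge \<open>N\<close>, as the received names are arbitrary.\<close>

primrec safe :: "tree \<Rightarrow> name set \<Rightarrow> bool" where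
  "safe TNil N \<longleftrightarrow> True"
| "safe (TTau t) N \<longleftrightarrow> safe t N"
| "safe (TInp S as xs f) N \<longleftrightarrow> set as \<inter> N \<noteq> {} \<and> (\<forall>bs. safe (f bs) N)"
| "safe (TOut as bs t) N \<longleftrightarrow> set as \<inter> N \<noteq> {} \<and> safe t N"
| "safe (TSum t u) N \<longleftrightarrow> safe t N \<and> safe u N"
| "safe (TPar t u) N \<longleftrightarrow> safe t N \<and> safe u N"
| "safe (TRes S f) N \<longleftrightarrow> (\<forall>m. safe (f m) (insert m N))"
| "safe (TBang t) N \<longleftrightarrow> safe t N"
| "safe (TMatch n m t) N \<longleftrightarrow> safe t N"

lemma safe_mono: "safe t N \<Longrightarrow> N \<subseteq> N' \<Longrightarrow> safe t N'"
proof (induction t arbitrary: N N')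
  case (TRes S f)
  then show ?case by (metis insert_mono rangeI safe.simps(7))
next
  case (TInp S as xs f)
  then show ?case by simp (metis disjoint_iff rangeI subsetD)
qed auto

text \<open>Quantifying over all substitutions makes \<open>safe_proc_Res\<close> free of freshness conditions.\<close>

definition safe_proc :: "name set \<Rightarrow> proc \<Rightarrow> bool" where
  "safe_proc N P \<longleftrightarrow> (\<forall>\<rho>. safe (sem \<rho> P) (\<rho> ` N))"

lemma safe_proc_mono: "safe_proc N P \<Longrightarrow> N \<subseteq> N' \<Longrightarrow> safe_proc N' P"
  unfolding safe_proc_def by (meson image_mono safe_mono)

lemma safe_proc_Res: "safe_proc N (Res n P) \<longleftrightarrow> safe_proc (insert n N) P"
proof
  assume s: "safe_proc N (Res n P)"
  show "safe_proc (insert n N) P" unfolding safe_proc_def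
  proof
    fix \<rho>
    have "safe (sem (\<rho>(n := \<rho> n)) P) (insert (\<rho> n) (\<rho> ` N))"
      using s unfolding safe_proc_def by (metis safe.simps(7) sem.simps(7))
    then show "safe (sem \<rho> P) (\<rho> ` insert n N)" by simp
  qed
next
  assume s: "safe_proc (insert n N) P"
  show "safe_proc N (Res n P)" unfolding safe_proc_def
  proof
    fix \<rho>
    have "safe (sem (\<rho>(n := m)) P) (insert m (\<rho> ` N))" for m
    proof (rule safe_mono)
      show "safe (sem (\<rho>(n := m)) P) (\<rho>(n := m) ` insert n N)" using s unfolding safe_proc_def by blast
      show "\<rho>(n := m) ` insert n N \<subseteq> insert m (\<rho> ` N)" by auto
    qed
    then show "safe (sem \<rho> (Res n P)) (\<rho> ` N)" by simp
  qed
qed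

lemma safe_proc_foldr_Res: "safe_proc N (foldr Res ns P) \<longleftrightarrow> safe_proc (set ns \<union> N) P"
  by (induction ns arbitrary: N) (auto simp: safe_proc_Res)

lemma safe_proc_Par: "safe_proc N (Par P Q) \<longleftrightarrow> safe_proc N P \<and> safe_proc N Q"
  by (auto simp: safe_proc_def)

text \<open>Extruded names lose their restriction and thus join \<open>N\<close>; a communication
  restricts them again, so internal steps leave \<open>N\<close> as it is.\<close>

lemma safe_proc_step:
  "step P \<alpha> P' \<Longrightarrow> safe_proc N P \<Longrightarrow> safe_proc (bn \<alpha> \<union> N) P' \<and>
     (case \<alpha> of ATau \<Rightarrow> True | AInp as bs \<Rightarrow> set as \<inter> N \<noteq> {} | AOut as ns bs \<Rightarrow> set as \<inter> N \<noteq> {})"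
proof (induction arbitrary: N rule: step.induct)
  case (Inp xs bs \<sigma> as P)
  have \<sigma>: "\<sigma> = bind_pat id xs bs" and len: "length bs = length xs"
    using Inp(1) unfolding pat_match_iff by (simp, metis length_canon_pat length_pat_inst)
  have "safe (sem \<rho> (subst \<sigma> P)) (\<rho> ` N)" for \<rho>
  proof -
    have "sem \<rho> (subst \<sigma> P) = sem (bind_pat \<rho> xs (map \<rho> bs)) P"
      unfolding sem_subst \<sigma>
      by (rule sem_cong) (auto simp: bind_pat_def override_on_def len first_pos_less)
    then show ?thesis using Inp(2) unfolding safe_proc_def by simp
  qed
  moreover have "safe (sem id (Pre (Inp as xs) P)) (id ` N)"
    using Inp(2) unfolding safe_proc_def by blast
  ultimately show ?case by (simp add: safe_proc_def)
next
  case (Out as bs P)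
  have "safe (sem id (Pre (Out as bs) P)) (id ` N)"
    using Out unfolding safe_proc_def by blast
  then show ?case using Out by (simp add: safe_proc_def)
next
  case (ParL P \<alpha> P' Q)
  then show ?case using safe_proc_mono[of N Q "bn \<alpha> \<union> N"] by (auto simp: safe_proc_Par)
next
  case (ParR Q \<alpha> Q' P)
  then show ?case using safe_proc_mono[of N P "bn \<alpha> \<union> N"] by (auto simp: safe_proc_Par)
next
  case (ComL P as bs P' Q ns Q')
  then show ?case
    using safe_proc_mono[of N P' "set ns \<union> N"] by (auto simp: safe_proc_Par safe_proc_foldr_Res)
next
  case (ComR P as ns bs P' Q Q')
  then show ?case
    using safe_proc_mono[of N Q' "set ns \<union> N"] by (auto simp: safe_proc_Par safe_proc_foldr_Res)
next
  case (Res P \<alpha> P' n)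
  from Res(3)[of "insert n N"] Res(2,4) show ?case
    by (cases \<alpha>) (auto simp: safe_proc_Res)
next
  case (Open P as ns bs P' n)
  from Open(4)[of "insert n N"] Open(3,5) show ?case
    by (auto simp: safe_proc_Res)
next
  case (Alpha P Q \<alpha> Q' P')
  then show ?case using sem_alpha[OF Alpha(1)] sem_alpha[OF Alpha(3)] by (simp add: safe_proc_def)
qed (auto simp: safe_proc_def)

lemma safe_proc_invisible:
  assumes "safe_proc {} P"
  shows "invisible P"
proof -
  have safe: "safe_proc {} Q" if "weak P Q" for Q
    using that unfolding weak_def
  proof (induction rule: rtranclp_induct)
    case base
    show ?case by (rule assms)
  next
    case (step Q Q')
    then show ?case using safe_proc_step[OF step(2)] by simp
  qed
  have "\<not> visible \<alpha>" if "weak P Q" "step Q \<alpha> Q'" for Q \<alpha> Q'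
    using safe_proc_step[OF that(2) safe[OF that(1)]] by (simp add: visible_def split: action.splits)
  then show ?thesis unfolding invisible_def may_act_def by blast
qed

text \<open>Phrased through the tree so that the case \<open>Alpha\<close> passes by
  \<open>sem_alpha\<close>; in the cases with another top node the assumption is
  contradictory.\<close>

lemma step_Match_eq: "step P \<alpha> P' \<Longrightarrow> sem id P = TMatch n m t \<Longrightarrow> n = m"
  by (induction rule: step.induct) (simp_all add: sem_alpha)

lemma not_strongly_replacement_free: "\<not> strongly_replacement_free"
proof
  assume srf: strongly_replacement_free
  \<comment> \<open>The names 0 and 1 are compared, 3 carries the visible output, and 2 is the
    private channel over which 1 is received for 0. Restricting 2 hides the prefixes of
    \<open>C\<close> itself.\<close>
  define I where "I = Match 0 1 (Pre (Out [3] []) PNil)"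
  define C where "C = CRes 2 (CParL (CPre (Inp [2] [Place 0]) Hole) (Pre (Out [2] [1]) PNil))"
  have "\<not> step I \<alpha> I'" for \<alpha> I'
    using step_Match_eq[of I \<alpha> I' 0 1] by (auto simp: I_def)
  then have "invisible I"
    unfolding invisible_def may_act_def weak_def by (metis converse_rtranclpE)
  moreover have "fill C I \<Down>"
  proof -
    let ?\<sigma> = "bind_pat id [Place 0] [1]"
    let ?J = "Match 1 1 (Pre (Out [3] []) PNil)"
    have "pat_match [Place 0] [1] ?\<sigma>"
      by (simp add: pat_match_iff canon_pat_def pat_map_def pat_inst_def first_pos_def)
    from step.Inp[OF this, of "[2]" I]
    have inp: "step (Pre (Inp [2] [Place 0]) I) (AInp [2] [1]) (subst ?\<sigma> I)" .
    have J: "subst ?\<sigma> I = ?J"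
      by (simp add: I_def bind_pat_def override_on_def places_def first_pos_def)
    have "step (Par (Pre (Inp [2] [Place 0]) I) (Pre (Out [2] [1]) PNil)) ATau (foldr Res [] (Par ?J PNil))"
      by (rule step.ComL[OF inp[unfolded J] step.Out]) simp
    then have 1: "step (fill C I) ATau (Res 2 (Par ?J PNil))"
      unfolding C_def by (auto intro: step.Res)
    have "step (Res 2 (Par ?J PNil)) (AOut [3] [] []) (Res 2 (Par PNil PNil))"
      by (intro step.Res step.ParL step.Match step.Out) auto
    then have "Res 2 (Par ?J PNil) \<Down>"
      by (rule step_may_act) (simp add: visible_def)
    then show ?thesis using tau_may_act[OF 1] by blast
  qed
  ultimately have "fill C PNil \<Down>"
    using srf unfolding strongly_replacement_free_def by blast
  \<comment> \<open>With \<open>PNil\<close> in the hole, every prefix has the restricted name 2 as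
    its subject.\<close>
  moreover have "invisible (fill C PNil)"
    by (rule safe_proc_invisible) (simp add: C_def safe_proc_def)
  ultimately show False unfolding invisible_def by blast
qed

theorem theorem4p4: "weakly_replacement_free"
  unfolding weakly_replacement_free_def
  using replacement_free not_strongly_replacement_free by blast

end
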